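(* Let $\mathbb{K}\in\{\mathbb{R},\mathbb{C}\}$. Let $S_1,\dots,S_M$ be non-trivial, independent linear subspaces of $\mathbb{K}^m$ with dimensions $d_1,\dots,d_M$, let $d_{\max}=\max_i d_i$ and $\mathcal{U}=\bigcup_{i=1}^M S_i$. Let $\mathbf{W}=[w_1\cdots w_n]\in\mathbb{K}^{m\times n}$ be a rank $r$ matrix whose columns are drawn from $\mathcal{U}$, such that the columns drawn from each $S_i$ form a generic set for $S_i$. Let $I\subset\{1,\dots,m\}$, $J\subset\{1,\dots,n\}$ with $|I|=s$, $|J|=k$, let $C\in\mathbb{K}^{m\times k}$ consist of the columns of $\mathbf{W}$ indexed by $J$, $R\in\mathbb{K}^{s\times n}$ of the rows of $\mathbf{W}$ indexed by $I$, and $U\in\mathbb{K}^{s\times k}$ the submatrix of $\mathbf{W}$ indexed by $I\times J$, and assume $\operatorname{rank}(U)=r$ (so that $\mathbf{W}=CU^\dagger R$). Let $Y=U^\dagger R$ and let $Q$ be either $\mathrm{bin}(Y^*Y)$ or $\mathrm{abs}(Y^*Y)$. Then $\Xi_{\mathbf{W}}=Q^{d_{\max}}$ is a similarity matrix for $\mathbf{W}$.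
   Context: Subspaces $S_1,\dots,S_M$ of $\mathbb{K}^m$ are independent if $\dim(S_1+\dots+S_M)=\dim S_1+\dots+\dim S_M\le m$. A set of data $\mathbf{W}$ drawn from a subspace $S$ of dimension $d$ is generic if it has more than $d$ elements and every $d$ vectors from it form a basis of $S$. For a matrix $A$, $\mathrm{abs}(A)(i,j)=|A(i,j)|$ and $\mathrm{bin}(A)(i,j)=1$ if $A(i,j)\neq 0$ and $0$ otherwise. A matrix $\Xi$ is a similarity matrix for $\mathbf{W}$ (whose columns lie in $\mathcal{U}$) if $\Xi$ is symmetric and $\Xi(i,j)\neq 0$ if and only if $w_i$ and $w_j$ come from the same subspace $S_l$. $U^\dagger$ is the Moore--Penrose pseudoinverse; $Q^{d_{\max}}$ is the ordinary matrix power. *)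

theory Defs
  imports "HOL-Analysis.Analysis" "Jordan_Normal_Form.Schur_Decomposition" "Jordan_Normal_Form.DL_Rank_Submatrix"
begin

text \<open>K is either the reals or the complex numbers.  We capture this by a type class
  of normed fields with a conjugation satisfying conj(x) * x = |x|^2 (an "RCLike" field);
  its instances are real and complex.\<close>

class rc_field = conjugatable_field + real_normed_field +
  assumes conjugate_mult_self: "conjugate (x::'a) * x = ((norm x)\<^sup>2) *\<^sub>R 1"

instance real :: rc_field
  by standard (simp add: power2_eq_square)

instance complex :: rc_field
  by standard (simp add: scaleR_conv_of_real complex_norm_square[symmetric] mult.commute)

definition lin_subspace :: "nat \<Rightarrow> 'a::field vec set \<Rightarrow> bool" where
  "lin_subspace m S \<longleftrightarrow> subspace class_ring S (module_vec TYPE('a) m)"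

definition sub_dim :: "nat \<Rightarrow> 'a::field vec set \<Rightarrow> nat" where
  "sub_dim m S = vectorspace.dim class_ring ((module_vec TYPE('a) m)\<lparr>carrier := S\<rparr>)"

text \<open>Independence: dim(S_1 + ... + S_M) = dim S_1 + ... + dim S_M <= m;
  the sum of subspaces is the span of their union.\<close>
definition independent_subspaces :: "nat \<Rightarrow> nat \<Rightarrow> (nat \<Rightarrow> 'a::field vec set) \<Rightarrow> bool" where
  "independent_subspaces m M S \<longleftrightarrow>
     sub_dim m (LinearCombinations.module.span class_ring (module_vec TYPE('a) m) (\<Union>l<M. S l)) = (\<Sum>l<M. sub_dim m (S l))
     \<and> (\<Sum>l<M. sub_dim m (S l)) \<le> m"

definition generic_cols :: "nat \<Rightarrow> 'a::field vec set \<Rightarrow> 'a mat \<Rightarrow> nat set \<Rightarrow> bool" where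
  "generic_cols m S W T \<longleftrightarrow>
     sub_dim m S < card T \<and>
     (\<forall>T' \<subseteq> T. card T' = sub_dim m S \<longrightarrow>
        inj_on (col W) T' \<and>
        vectorspace.basis class_ring ((module_vec TYPE('a) m)\<lparr>carrier := S\<rparr>) (col W ` T'))"

definition pinv :: "'a::conjugatable_field mat \<Rightarrow> 'a mat" where
  "pinv A = (THE X. X \<in> carrier_mat (dim_col A) (dim_row A) \<and>
      A * X * A = A \<and> X * A * X = X \<and>
      mat_adjoint (A * X) = A * X \<and> mat_adjoint (X * A) = X * A)"

definition bin_mat :: "'a::zero_neq_one mat \<Rightarrow> 'a mat" where
  "bin_mat A = mat (dim_row A) (dim_col A) (\<lambda>ij. if A $$ ij \<noteq> 0 then 1 else 0)"

definition abs_mat :: "'a::real_normed_field mat \<Rightarrow> 'a mat" where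
  "abs_mat A = mat (dim_row A) (dim_col A) (\<lambda>ij. of_real (norm (A $$ ij)))"

definition similarity_matrix :: "'a::zero mat \<Rightarrow> nat \<Rightarrow> (nat \<Rightarrow> 'a vec set) \<Rightarrow> 'a mat \<Rightarrow> bool" where
  "similarity_matrix W M S Xi \<longleftrightarrow>
     Xi \<in> carrier_mat (dim_col W) (dim_col W) \<and> transpose_mat Xi = Xi \<and>
     (\<forall>i<dim_col W. \<forall>j<dim_col W.
        Xi $$ (i,j) \<noteq> 0 \<longleftrightarrow> (\<exists>l<M. col W i \<in> S l \<and> col W j \<in> S l))"

end

theory Submission
  imports Defs
begin

text \<open>
  Let \<open>C\<close> be the selected columns of \<open>W\<close>. Since \<open>rank U = rank W\<close>, the columns of \<open>C\<close> span those of \<open>W\<close>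
  and \<open>ker U = ker C\<close>, so the \<open>j\<close>-th column \<open>y\<^sub>j\<close> of \<open>Y\<close> is the solution of \<open>C y = w\<^sub>j\<close> that is orthogonal
  to \<open>ker C\<close>. As the subspaces are independent, \<open>ker C\<close> splits along the blocks of columns coming from
  the same subspace; hence \<open>y\<^sub>j\<close> is supported on the block of \<open>w\<^sub>j\<close>, and the Gram matrix \<open>Y\<^sup>*Y\<close> vanishes
  between different subspaces.

  Within the block of a \<open>d\<close>-dimensional subspace the \<open>y\<^sub>j\<close> satisfy the same linear relations as the
  \<open>w\<^sub>j\<close>, so they are generic too. Let \<open>N\<^sub>t\<close> be the set of indices reachable from a given one by a walk of
  length \<open>t\<close> along nonzero entries of \<open>Y\<^sup>*Y\<close>; the diagonal entries are nonzero, so \<open>N\<^sub>t\<close> increases.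
  If \<open>N\<^sub>t = N\<^sub>t\<^sub>+\<^sub>1\<close> has \<open>e < d\<close> elements, then \<open>d - e + 1\<close> further vectors lie in the \<open>(d - e)\<close>-dimensional
  orthogonal complement of \<open>N\<^sub>t\<close>, against genericity. So \<open>N\<^sub>d\<^sub>-\<^sub>1\<close> contains a basis, and no vector of the
  block is orthogonal to all of it. Finally, the entries of \<open>Q\<close> are nonnegative, so nonzero entries
  of \<open>Q\<^sup>t\<close> correspond to walks of length \<open>t\<close>.
\<close>

unbundle no vec_syntax

subsection \<open>The Moore--Penrose pseudoinverse\<close>

text \<open>Taking norms in conj(x) x = |x|^2 and cancelling |x|. It makes the entrywise absolute
  values of a Hermitian matrix symmetric.\<close>

lemma norm_conjugate [simp]: "norm (conjugate (x::'a::rc_field)) = norm x"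
proof (cases "x = 0")
  case False
  have "norm (conjugate x) * norm x = norm ((norm x)\<^sup>2 *\<^sub>R (1::'a))"
    by (simp only: conjugate_mult_self[symmetric] norm_mult)
  with False show ?thesis by (simp add: power2_eq_square)
qed simp

lemma sum_conjugate_mult_self:
  "(\<Sum>i\<in>A. conjugate (f i) * f i) = of_real (\<Sum>i\<in>A. (norm (f i :: 'a::rc_field))\<^sup>2)"
  by (simp add: conjugate_mult_self of_real_def scaleR_sum_left)

text \<open>Definiteness of the standard Hermitian form: its value on a vector is a real sum of
  squares of norms.\<close>

lemma sum_conjugate_mult_self_eq_0_iff:
  assumes "finite A"
  shows "(\<Sum>i\<in>A. conjugate (f i) * f i) = 0 \<longleftrightarrow> (\<forall>i\<in>A. f i = (0::'a::rc_field))"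
  unfolding sum_conjugate_mult_self of_real_eq_0_iff
  using assms by (subst sum_nonneg_eq_0_iff) auto

lemma mat_adjoint_dim [simp]:
  "dim_row (mat_adjoint A) = dim_col A" "dim_col (mat_adjoint A) = dim_row A"
  by (simp_all add: mat_adjoint_def)

lemma mat_adjoint_carrier [simp]:
  "A \<in> carrier_mat nr nc \<Longrightarrow> mat_adjoint A \<in> carrier_mat nc nr"
  by auto

lemma mat_adjoint_index [simp]:
  "i < dim_col A \<Longrightarrow> j < dim_row A \<Longrightarrow> mat_adjoint A $$ (i, j) = conjugate (A $$ (j, i))"
  by (simp add: mat_adjoint_def mat_of_rows_index)

lemma mat_adjoint_adjoint [simp]: "mat_adjoint (mat_adjoint A) = A"
  by (rule eq_matI) auto

lemma mat_adjoint_mult: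
  assumes "dim_col A = dim_row B"
  shows "mat_adjoint (A * B) = mat_adjoint B * mat_adjoint A"
  using assms
  by (intro eq_matI) (auto simp: scalar_prod_def sum_conjugate conjugate_dist_mul mult.commute)

lemma mat_adjoint_mult_self_index:
  assumes "i < dim_col A" "j < dim_col A"
  shows "(mat_adjoint A * A) $$ (i, j) = (\<Sum>p<dim_row A. conjugate (A $$ (p, i)) * A $$ (p, j))"
  using assms by (simp add: scalar_prod_def lessThan_atLeast0)

lemma mat_adjoint_mult_self_eq_0:
  fixes A :: "'a::rc_field mat"
  assumes "A \<in> carrier_mat nr nc" "mat_adjoint A * A = 0\<^sub>m nc nc"
  shows "A = 0\<^sub>m nr nc"
proof (rule eq_matI)
  fix i j assume ij: "i < dim_row (0\<^sub>m nr nc :: 'a mat)" "j < dim_col (0\<^sub>m nr nc :: 'a mat)"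
  then have "(mat_adjoint A * A) $$ (j, j) = 0" using assms(2) by simp
  then have "(\<Sum>p<dim_row A. conjugate (A $$ (p, j)) * A $$ (p, j)) = 0"
    using ij assms(1) by (subst (asm) mat_adjoint_mult_self_index) auto
  then show "A $$ (i, j) = 0\<^sub>m nr nc $$ (i, j)"
    using ij assms(1) by (simp add: sum_conjugate_mult_self_eq_0_iff)
qed (use assms in auto)

lemma assoc_mult_mat_dim:
  "dim_col A = dim_row B \<Longrightarrow> dim_col B = dim_row C \<Longrightarrow> (A * B) * C = A * (B * C)"
  for A B C :: "'a::semiring_0 mat"
  by (rule assoc_mult_mat[of A "dim_row A" "dim_row B" B "dim_row C" C "dim_col C"]) auto

section \<open>Generalised inverses and the Penrose conditions\<close>

text \<open>The reduced row echelon form \<open>E = P * A\<close>, with \<open>P\<close> invertible,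
  has the easy generalised inverse \<open>Z0\<close>, which sends the unit vector of a pivot row to
  that of its pivot column. Then \<open>Z0 * P\<close> serves for \<open>A\<close>.\<close>

lemma generalized_inverse_exists:
  fixes A :: "'a::field mat"
  assumes A: "A \<in> carrier_mat nr nc"
  obtains Z where "Z \<in> carrier_mat nc nr" "A * Z * A = A"
proof -
  define E where "E = gauss_jordan_single A"
  note gj = gauss_jordan_single[OF A E_def[symmetric]]
  obtain P Q where PQ: "E = P * A" "P \<in> carrier_mat nr nr" "Q \<in> carrier_mat nr nr" "Q * P = 1\<^sub>m nr"
    using gj(4) by blast
  have E: "E \<in> carrier_mat nr nc" using gj(2) .
  obtain f where "pivot_fun E f nc" using gj(3) E by (auto simp: row_echelon_form_def)
  note f = pivot_funD[OF _ this, of nr]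
  \<comment> \<open>A zero row has pivot position \<open>nc\<close>, which no row index of
    \<open>Z0\<close> attains, so the corresponding column of \<open>Z0\<close> is zero.\<close>
  define Z0 where "Z0 = mat nc nr (\<lambda>(j, i). if f i = j then 1 else (0::'a))"
  have Z0: "Z0 \<in> carrier_mat nc nr" by (simp add: Z0_def)
  \<comment> \<open>Pivot columns of \<open>E\<close> are unit vectors, so \<open>E * Z0\<close> is
    the diagonal projection onto the pivot rows.\<close>
  have EZ: "(E * Z0) $$ (a, i) = (if a = i \<and> f i < nc then 1 else 0)" if "a < nr" "i < nr" for a i
  proof -
    have "(E * Z0) $$ (a, i) = (\<Sum>j = 0..<nc. E $$ (a, j) * (if f i = j then 1 else 0))"
      using that E by (simp add: scalar_prod_def Z0_def)
    also have "\<dots> = (if f i < nc then E $$ (a, f i) else 0)"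
      by (simp add: if_distrib[of "(*) _"] sum.delta cong: if_cong)
    also have "\<dots> = (if a = i \<and> f i < nc then 1 else 0)"
      using f(4)[of i] f(5)[of i a] that E by auto
    finally show ?thesis .
  qed
  have "E * Z0 * E = E"
  proof (rule eq_matI)
    fix a b assume "a < dim_row E" "b < dim_col E"
    then have ab: "a < nr" "b < nc" using E by auto
    have "(E * Z0 * E) $$ (a, b) = (\<Sum>i = 0..<nr. (E * Z0) $$ (a, i) * E $$ (i, b))"
      using ab E Z0 by (subst index_mult_mat(1)) (auto simp: scalar_prod_def)
    also have "\<dots> = (\<Sum>i = 0..<nr. if i = a then (if f a < nc then E $$ (a, b) else 0) else 0)"
      using ab by (intro sum.cong) (auto simp: EZ simp del: index_mult_mat(1))
    also have "\<dots> = E $$ (a, b)"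
      using ab f(2)[of a b] f(1)[of a] E by auto
    finally show "(E * Z0 * E) $$ (a, b) = E $$ (a, b)" .
  qed (use E in auto)
  have QE: "Q * E = A"
    unfolding PQ(1) assoc_mult_mat[OF PQ(3,2) A, symmetric] PQ(4) using A by (rule left_mult_one_mat)
  note [simp] = A[THEN carrier_matD(1)] A[THEN carrier_matD(2)] E[THEN carrier_matD(1)] E[THEN carrier_matD(2)]
    Z0[THEN carrier_matD(1)] Z0[THEN carrier_matD(2)] PQ(2)[THEN carrier_matD(1)] PQ(2)[THEN carrier_matD(2)]
    PQ(3)[THEN carrier_matD(1)] PQ(3)[THEN carrier_matD(2)]
  have "A * (Z0 * P) * A = A * Z0 * (P * A)" by (simp add: assoc_mult_mat_dim)
  also have "\<dots> = Q * E * Z0 * E" by (simp only: QE PQ(1)[symmetric])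
  also have "\<dots> = Q * (E * Z0 * E)" by (simp add: assoc_mult_mat_dim)
  also have "\<dots> = A" by (simp only: \<open>E * Z0 * E = E\<close> QE)
  finally show thesis using that[of "Z0 * P"] Z0 PQ by simp
qed

text \<open>For \<open>D = A * (B - C)\<close> the hypothesis says adj(A) D = 0, hence adj(D) D = 0,
  and definiteness gives D = 0.\<close>

lemma mult_adjoint_mult_cancel:
  fixes A :: "'a::rc_field mat"
  assumes A: "A \<in> carrier_mat nr nc" and B: "B \<in> carrier_mat nc l" and C: "C \<in> carrier_mat nc l"
    and eq: "mat_adjoint A * (A * B) = mat_adjoint A * (A * C)"
  shows "A * B = A * C"
proof -
  define D where "D = A * (B - C)"
  have BC: "B - C \<in> carrier_mat nc l" using C by (rule minus_carrier_mat)
  have AB: "A * B \<in> carrier_mat nr l" and AC: "A * C \<in> carrier_mat nr l"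
    by (rule mult_carrier_mat[OF A B], rule mult_carrier_mat[OF A C])
  have D: "D \<in> carrier_mat nr l" unfolding D_def using A BC by (rule mult_carrier_mat)
  have D': "D = A * B - A * C"
    unfolding D_def by (rule mult_minus_distrib_mat[OF A B C])
  have "mat_adjoint A * D = mat_adjoint A * (A * B) - mat_adjoint A * (A * C)"
    unfolding D' by (rule mult_minus_distrib_mat[OF mat_adjoint_carrier[OF A] AB AC])
  also have "\<dots> = 0\<^sub>m nc l"
    unfolding eq by (rule minus_r_inv_mat[OF mult_carrier_mat[OF mat_adjoint_carrier[OF A] AC]])
  finally have AD: "mat_adjoint A * D = 0\<^sub>m nc l" .
  have "mat_adjoint D * D = mat_adjoint (B - C) * (mat_adjoint A * D)"
  proof -
    have "mat_adjoint D = mat_adjoint (B - C) * mat_adjoint A"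
      unfolding D_def using A BC by (intro mat_adjoint_mult) auto
    then show ?thesis
      using assoc_mult_mat[OF mat_adjoint_carrier[OF BC] mat_adjoint_carrier[OF A] D] by simp
  qed
  also have "\<dots> = 0\<^sub>m l l"
    unfolding AD by (rule right_mult_zero_mat[OF mat_adjoint_carrier[OF BC]])
  finally have "D = 0\<^sub>m nr l" by (rule mat_adjoint_mult_self_eq_0[OF D])
  show ?thesis
  proof (rule eq_matI)
    fix i j assume ij: "i < dim_row (A * C)" "j < dim_col (A * C)"
    then have "(A * B - A * C) $$ (i, j) = 0"
      using \<open>D = 0\<^sub>m nr l\<close> AC unfolding D' by (metis carrier_matD index_zero_mat(1))
    then show "(A * B) $$ (i, j) = (A * C) $$ (i, j)"
      using ij AB AC by simp
  qed (use AB AC in \<open>simp_all del: index_mult_mat\<close>)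
qed

text \<open>Take X = Z adj(A) with Z a generalised inverse of adj(A) A: the equation for Z is the
  desired A X A = A multiplied by adj(A), which cancels. Then A X is the orthogonal projection onto
  the range of A.\<close>

lemma least_squares_inverse_exists:
  fixes A :: "'a::rc_field mat"
  assumes A: "A \<in> carrier_mat nr nc"
  obtains X where "X \<in> carrier_mat nc nr" "A * (X * A) = A" "mat_adjoint (A * X) = A * X"
proof -
  let ?B = "mat_adjoint A"
  obtain Z where Z: "Z \<in> carrier_mat nc nc" "(?B * A) * Z * (?B * A) = ?B * A"
    by (rule generalized_inverse_exists[OF mult_carrier_mat[OF mat_adjoint_carrier[OF A] A]])
  note [simp] = A[THEN carrier_matD(1)] A[THEN carrier_matD(2)] Z(1)[THEN carrier_matD(1)] Z(1)[THEN carrier_matD(2)]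
  let ?X = "Z * ?B"
  have X: "?X \<in> carrier_mat nc nr" by (rule mult_carrier_mat[OF Z(1) mat_adjoint_carrier[OF A]])
  have "A * (?X * A) = A * 1\<^sub>m nc"
  proof (rule mult_adjoint_mult_cancel[OF A mult_carrier_mat[OF X A] one_carrier_mat])
    show "?B * (A * (?X * A)) = ?B * (A * 1\<^sub>m nc)"
      using Z(2) right_mult_one_mat[OF A] by (simp add: assoc_mult_mat_dim)
  qed
  then have 1: "A * (?X * A) = A" by (simp only: right_mult_one_mat[OF A])
  have "mat_adjoint (A * ?X) = A * (mat_adjoint Z * ?B)"
    by (simp add: mat_adjoint_mult assoc_mult_mat_dim)
  also have "\<dots> = A * (?X * A) * (mat_adjoint Z * ?B)" by (simp only: 1)
  also have "\<dots> = A * ?X * mat_adjoint (A * ?X)"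
    by (simp add: mat_adjoint_mult assoc_mult_mat_dim)
  finally have H: "mat_adjoint (A * ?X) = A * ?X * mat_adjoint (A * ?X)" .
  \<comment> \<open>The right side of \<open>H\<close> has the form P adj(P), so it is self-adjoint
    whether or not \<open>Z\<close> is; hence so is \<open>A * ?X\<close>.\<close>
  have "mat_adjoint (mat_adjoint (A * ?X)) = mat_adjoint (A * ?X * mat_adjoint (A * ?X))"
    by (rule arg_cong[OF H, of mat_adjoint])
  also have "\<dots> = A * ?X * mat_adjoint (A * ?X)"
    by (subst mat_adjoint_mult) (simp_all only: mat_adjoint_adjoint mat_adjoint_dim index_mult_mat)
  finally have "mat_adjoint (mat_adjoint (A * ?X)) = A * ?X * mat_adjoint (A * ?X)" .
  from trans[OF H this[symmetric]] have "mat_adjoint (A * ?X) = A * ?X" by simp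
  then show thesis by (rule that[OF X 1])
qed

text \<open>The Penrose conditions, separated from the \<open>THE\<close> in \<open>pinv\<close> so
  that existence and uniqueness can be shown first.\<close>

definition is_pinv :: "'a::conjugatable_field mat \<Rightarrow> 'a mat \<Rightarrow> bool" where
  "is_pinv A X \<longleftrightarrow> X \<in> carrier_mat (dim_col A) (dim_row A) \<and>
      A * X * A = A \<and> X * A * X = X \<and>
      mat_adjoint (A * X) = A * X \<and> mat_adjoint (X * A) = X * A"

text \<open>If X and Y are generalised inverses of A with A X and Y A self-adjoint, then Y A X
  satisfies all four conditions. Such a Y is the adjoint of a least squares inverse of
  adj(A).\<close>

lemma is_pinv_exists: "\<exists>X. is_pinv (A::'a::rc_field mat) X"
proof -
  define nr nc where "nr = dim_row A" "nc = dim_col A"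
  have A: "A \<in> carrier_mat nr nc" by (simp add: nr_nc_def)
  obtain X where X: "X \<in> carrier_mat nc nr" "A * (X * A) = A" "mat_adjoint (A * X) = A * X"
    by (rule least_squares_inverse_exists[OF A])
  obtain T where T: "T \<in> carrier_mat nr nc" "mat_adjoint A * (T * mat_adjoint A) = mat_adjoint A"
     "mat_adjoint (mat_adjoint A * T) = mat_adjoint A * T"
    by (rule least_squares_inverse_exists[OF mat_adjoint_carrier[OF A]])
  define Y where "Y = mat_adjoint T"
  have Y: "Y \<in> carrier_mat nc nr" using T by (simp add: Y_def)
  note [simp] = A[THEN carrier_matD(1)] A[THEN carrier_matD(2)] X(1)[THEN carrier_matD(1)]
    X(1)[THEN carrier_matD(2)] T(1)[THEN carrier_matD(1)] T(1)[THEN carrier_matD(2)]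
    Y(1)[THEN carrier_matD(1)] Y(1)[THEN carrier_matD(2)]
  have YA: "mat_adjoint (Y * A) = Y * A"
    using T(3) by (simp add: Y_def mat_adjoint_mult)
  have AYA: "A * (Y * A) = A"
    using arg_cong[OF T(2), of mat_adjoint] by (simp add: Y_def mat_adjoint_mult assoc_mult_mat_dim)
  have 1: "A * (Y * (A * X)) = A * X"
    using arg_cong[OF AYA, of "\<lambda>B. B * X"] by (simp add: assoc_mult_mat_dim)
  have "Y * (A * X) * A * (Y * (A * X)) = Y * (A * (X * A)) * (Y * (A * X))"
    by (simp add: assoc_mult_mat_dim)
  also have "\<dots> = Y * (A * X)" using X(2) 1 by (simp add: assoc_mult_mat_dim)
  finally have "Y * (A * X) * A * (Y * (A * X)) = Y * (A * X)" .
  moreover have "A * (Y * (A * X)) * A = A" using 1 X(2) by (simp add: assoc_mult_mat_dim)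
  moreover have "Y * (A * X) * A = Y * A" using X(2) by (simp add: assoc_mult_mat_dim)
  ultimately show ?thesis
    unfolding is_pinv_def using 1 X(3) YA by (intro exI[of _ "Y * (A * X)"]) (auto intro: carrier_matI)
qed

text \<open>A X and A Y are self-adjoint idempotents with the same range, so they agree; dually X A
  = Y A. Then X = X A X = Y A X = Y A Y = Y.\<close>

lemma is_pinv_unique:
  assumes "is_pinv (A::'a::rc_field mat) X" "is_pinv A Y"
  shows "X = Y"
proof -
  have X: "A * X * A = A" "X * A * X = X" "mat_adjoint (A * X) = A * X" "mat_adjoint (X * A) = X * A"
    and Y: "A * Y * A = A" "Y * A * Y = Y" "mat_adjoint (A * Y) = A * Y" "mat_adjoint (Y * A) = Y * A"
    and [simp]: "dim_row X = dim_col A" "dim_col X = dim_row A" "dim_row Y = dim_col A" "dim_col Y = dim_row A"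
    using assms unfolding is_pinv_def carrier_mat_def by blast+
  have "A * X = mat_adjoint (A * Y * A * X)" using X Y by simp
  also have "\<dots> = mat_adjoint ((A * Y) * (A * X))" by (simp add: assoc_mult_mat_dim)
  also have "\<dots> = (A * X) * (A * Y)" using X Y by (subst mat_adjoint_mult) auto
  also have "\<dots> = (A * X * A) * Y" by (simp add: assoc_mult_mat_dim)
  finally have 1: "A * X = A * Y" using X by simp
  have "X * A = mat_adjoint (X * (A * Y * A))" using X Y by simp
  also have "\<dots> = mat_adjoint ((X * A) * (Y * A))" by (simp add: assoc_mult_mat_dim)
  also have "\<dots> = (Y * A) * (X * A)" using X Y by (subst mat_adjoint_mult) auto
  also have "\<dots> = Y * (A * X * A)" by (simp add: assoc_mult_mat_dim)
  finally have 2: "X * A = Y * A" using X by simp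
  have "X = (X * A) * X" using X by simp
  also have "\<dots> = Y * (A * X)" using 2 by (simp add: assoc_mult_mat_dim)
  also have "\<dots> = Y * A * Y" using 1 by (simp add: assoc_mult_mat_dim)
  finally show ?thesis using Y by simp
qed

lemma is_pinv_pinv: "is_pinv (A::'a::rc_field mat) (pinv A)"
proof -
  have "\<exists>!X. is_pinv A X" using is_pinv_exists is_pinv_unique by blast
  from theI'[OF this] show ?thesis unfolding pinv_def is_pinv_def .
qed

subsection \<open>Coordinates and independent subspaces\<close>

context vec_space
begin

lemma lincomb_image_index:
  assumes "finite D" "inj_on v D" "v ` D \<subseteq> carrier_vec n" "i < n"
  shows "lincomb c (v ` D) $ i = (\<Sum>d\<in>D. c (v d) * v d $ i)"
  using assms by (simp add: lincomb_index sum.reindex)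

text \<open>Injectivity of \<open>v\<close> lets coefficients be indexed by \<open>D\<close> instead
  of by vectors, so that later arguments need only column indices and scalar equations.\<close>

lemma lin_indpt_image_iff:
  assumes D: "finite D" "inj_on v D" and v: "v ` D \<subseteq> carrier_vec n"
  shows "lin_indpt (v ` D) \<longleftrightarrow>
    (\<forall>c. (\<forall>i<n. (\<Sum>d\<in>D. c d * v d $ i) = 0) \<longrightarrow> (\<forall>d\<in>D. c d = 0))"
proof
  assume li: "lin_indpt (v ` D)"
  show "\<forall>c. (\<forall>i<n. (\<Sum>d\<in>D. c d * v d $ i) = 0) \<longrightarrow> (\<forall>d\<in>D. c d = 0)"
  proof (intro allI impI ballI)
    fix c d assume c: "\<forall>i<n. (\<Sum>d\<in>D. c d * v d $ i) = 0" and d: "d \<in> D"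
    define a where "a w = c (the_inv_into D v w)" for w
    have a: "a (v e) = c e" if "e \<in> D" for e
      using that D by (simp add: a_def the_inv_into_f_f)
    have "lincomb a (v ` D) = 0\<^sub>v n"
    proof (rule eq_vecI)
      fix i assume "i < dim_vec (0\<^sub>v n :: 'a vec)"
      then have i: "i < n" by simp
      have "lincomb a (v ` D) $ i = (\<Sum>e\<in>D. c e * v e $ i)"
        unfolding lincomb_image_index[OF D v i] by (rule sum.cong) (simp_all add: a)
      then show "lincomb a (v ` D) $ i = 0\<^sub>v n $ i" using c i by simp
    qed (simp add: lincomb_dim[OF finite_imageI[OF D(1)] v])
    then have "a (v d) = 0"
      using not_lindepD[OF li _ subset_refl, of a] d D by (simp add: Pi_def)
    then show "c d = 0" using a d by simp
  qed
next
  assume *: "\<forall>c. (\<forall>i<n. (\<Sum>d\<in>D. c d * v d $ i) = 0) \<longrightarrow> (\<forall>d\<in>D. c d = 0)"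
  show "lin_indpt (v ` D)"
  proof (rule finite_lin_indpt2)
    fix a assume a: "lincomb a (v ` D) = 0\<^sub>v n"
    have "(\<Sum>d\<in>D. a (v d) * v d $ i) = 0" if "i < n" for i
      using lincomb_image_index[OF D v that, of a] a that by simp
    then have "\<forall>i<n. (\<Sum>d\<in>D. a (v d) * v d $ i) = 0" by simp
    from *[THEN spec, THEN mp, OF this] show "\<forall>w\<in>v ` D. a w = 0" by simp
  qed (rule finite_imageI[OF D(1)], use v in simp)
qed

lemma span_imageE:
  assumes "finite D" "inj_on v D" "v ` D \<subseteq> carrier_vec n" "x \<in> span (v ` D)"
  obtains c where "\<And>i. i < n \<Longrightarrow> x $ i = (\<Sum>d\<in>D. c d * v d $ i)"
proof -
  obtain a where a: "lincomb a (v ` D) = x"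
    using finite_in_span[of "v ` D" x] assms by auto
  show thesis
    by (rule that[of "\<lambda>d. a (v d)"]) (use lincomb_image_index[OF assms(1-3), of _ a] a in simp)
qed

lemma subspace_carrier: "subspace class_ring S V \<Longrightarrow> S \<subseteq> carrier_vec n"
  by (auto simp: subspace_def submodule_def)

lemma subspace_basisD:
  assumes "subspace class_ring S V" "vectorspace.basis class_ring (vs S) B"
  shows "lin_indpt B" "span B = S" "B \<subseteq> S"
proof -
  interpret S: vectorspace class_ring "vs S" using assms(1) by (rule subspace_is_vs)
  show "B \<subseteq> S" using assms(2) by (simp add: S.basis_def)
  note dep = span_li_not_depend[OF this is_module[OF assms(1)]]
  show "lin_indpt B" "span B = S" using assms(2) dep by (simp_all add: S.basis_def)
qed

lemma subspace_basis_exists: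
  assumes S: "subspace class_ring S V"
  obtains B where "finite B" "vectorspace.basis class_ring (vs S) B"
proof -
  interpret S: vectorspace class_ring "vs S" using assms(1) by (rule subspace_is_vs)
  note car = subspace_carrier[OF S]
  have "\<exists>B. finite B \<and> maximal B (\<lambda>B. B \<subseteq> S \<and> lin_indpt B)"
  proof (rule maximal_exists)
    show "finite B \<and> card B \<le> dim" if "B \<subseteq> S \<and> lin_indpt B" for B
      using li_le_dim[of B] that car by auto
    show "{} \<subseteq> S \<and> lin_indpt {}" by (auto simp: lin_dep_def)
  qed
  then obtain B where B: "finite B" "maximal B (\<lambda>B. B \<subseteq> S \<and> lin_indpt B)" by blast
  have "(\<lambda>B. B \<subseteq> S \<and> lin_indpt B) = (\<lambda>B. B \<subseteq> carrier (vs S) \<and> S.lin_indpt B)"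
    using span_li_not_depend(2)[OF _ is_module[OF S]] by auto
  with B have "S.basis B" using S.max_li_is_basis[of B] by simp
  with B that show thesis by blast
qed

lemma subspace_sum_closed:
  assumes S: "subspace class_ring S V" and T: "finite T" and v: "\<And>t. t \<in> T \<Longrightarrow> v t \<in> S"
  shows "vec n (\<lambda>i. \<Sum>t\<in>T. c t * v t $ i) \<in> S"
proof -
  have sub: "submodule class_ring S V" using S by (rule is_module)
  show ?thesis using T v
  proof (induction T)
    case empty
    have "vec n (\<lambda>i. \<Sum>t\<in>{}. c t * v t $ i) = 0\<^sub>v n" by auto
    then show ?case using submodule.zero_closed[OF sub] by simp
  next
    case (insert t T)
    have "v t \<in> carrier_vec n" using insert.prems subspace_carrier[OF S] by auto
    then have "vec n (\<lambda>i. \<Sum>t\<in>insert t T. c t * v t $ i)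
        = c t \<cdot>\<^sub>v v t + vec n (\<lambda>i. \<Sum>t\<in>T. c t * v t $ i)"
      using insert.hyps by (intro eq_vecI) auto
    moreover have "c t \<cdot>\<^sub>v v t \<in> S"
      using submodule.smult_closed[OF sub, of "c t" "v t"] insert.prems by simp
    ultimately show ?case
      using submodule.m_closed[OF sub, of "c t \<cdot>\<^sub>v v t" "vec n (\<lambda>i. \<Sum>t\<in>T. c t * v t $ i)"] insert by simp
  qed
qed

text \<open>Bases of the \<open>S l\<close> together generate the span of the union, and by the
  dimension formula they have just as many members as its dimension, so they form one basis.
  Expanding each \<open>u l\<close> turns the vanishing sum into a relation in that basis.\<close>

lemma direct_sum_of_dim:
  fixes S :: "nat \<Rightarrow> 'a vec set"
  assumes S: "\<And>l. l < M \<Longrightarrow> subspace class_ring (S l) V"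
    and dim: "vectorspace.dim class_ring (vs (span (\<Union>l<M. S l))) =
      (\<Sum>l<M. vectorspace.dim class_ring (vs (S l)))"
    and u: "\<And>l. l < M \<Longrightarrow> u l \<in> S l" and sum: "\<And>i. i < n \<Longrightarrow> (\<Sum>l<M. u l $ i) = 0"
    and l: "l < M"
  shows "u l = 0\<^sub>v n"
proof -
  define B where "B l = (SOME B. finite B \<and> vectorspace.basis class_ring (vs (S l)) B)" for l
  have "finite (B l) \<and> vectorspace.basis class_ring (vs (S l)) (B l)" if "l < M" for l
    unfolding B_def by (rule someI_ex) (use subspace_basis_exists[OF S[OF that]] in blast)
  then have finB: "\<And>l. l < M \<Longrightarrow> finite (B l)"
    and B: "\<And>l. l < M \<Longrightarrow> vectorspace.basis class_ring (vs (S l)) (B l)"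
    by auto
  note BD = subspace_basisD[OF S B]
  have cardB: "vectorspace.dim class_ring (vs (S l)) = card (B l)" if "l < M" for l
    using vectorspace.dim_basis[OF subspace_is_vs[OF S[OF that]] finB[OF that] B[OF that]] .
  have car: "S l \<subseteq> carrier_vec n" if "l < M" for l using subspace_carrier[OF S[OF that]] .
  \<comment> \<open>The pairs record the subspace of each basis vector: a vector lying in two of the
    bases would count twice, which \<open>inj\<close> later excludes.\<close>
  define D where "D = Sigma {..<M} B"
  define X where "X = (\<Union>l<M. S l)"
  have Xc: "X \<subseteq> carrier_vec n" using car by (auto simp: X_def)
  have finD: "finite D" unfolding D_def using finB by (intro finite_SigmaI) auto
  have imD: "snd ` D = (\<Union>l<M. B l)" by (force simp: D_def)
  have Dc: "snd ` D \<subseteq> carrier_vec n"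
    unfolding imD by (rule UN_least) (use BD(3) car in \<open>meson lessThan_iff order_trans\<close>)
  have subX: "subspace class_ring (span X) V" using Xc by (intro span_is_subspace) simp
  interpret X: vectorspace class_ring "vs (span X)" using subX by (rule subspace_is_vs)
  have DX: "snd ` D \<subseteq> span X"
  proof -
    have "snd ` D \<subseteq> X" using imD BD(3) by (auto simp: X_def)
    then show ?thesis using in_own_span[of X] Xc by auto
  qed
  have "X \<subseteq> span (snd ` D)"
  proof
    fix x assume "x \<in> X"
    then obtain l where "l < M" "x \<in> S l" by (auto simp: X_def)
    then have "x \<in> span (B l)" using BD(2) by auto
    moreover have "span (B l) \<subseteq> span (snd ` D)"
      using imD \<open>l < M\<close> by (intro span_is_monotone) auto
    ultimately show "x \<in> span (snd ` D)" by blast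
  qed
  then have "span X \<subseteq> span (snd ` D)"
    using Dc by (intro span_is_subset is_module span_is_subspace) auto
  moreover have "span (snd ` D) \<subseteq> span X"
    using DX by (intro span_is_subset is_module subX)
  ultimately have gen: "X.span (snd ` D) = carrier (vs (span X))"
    using span_li_not_depend(1)[OF DX is_module[OF subX]] by simp
  have dimX: "X.dim = card D"
    using dim finB cardB by (simp add: D_def X_def)
  have le: "card (snd ` D) \<le> card D" using finD by (rule card_image_le)
  have basis: "X.basis (snd ` D)"
    using X.dim_gen_is_basis[OF _ _ gen] finD DX le dimX by simp
  then have "card (snd ` D) = card D"
    using X.dim_basis[of "snd ` D"] finD dimX by simp
  then have inj: "inj_on snd D" using finD by (rule eq_card_imp_inj_on[rotated])
  note indep = lin_indpt_image_iff[OF finD inj Dc, THEN iffD1, OF subspace_basisD(1)[OF subX basis],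
      THEN spec, THEN mp]
  have "\<exists>c. \<forall>i<n. u l $ i = (\<Sum>b\<in>B l. c b * b $ i)" if "l < M" for l
  proof -
    have "u l \<in> span ((\<lambda>b. b) ` B l)" using BD(2)[OF that that] u[OF that] by simp
    moreover have "(\<lambda>b. b) ` B l \<subseteq> carrier_vec n" using BD(3)[OF that that] car[OF that] by auto
    ultimately show ?thesis
      using span_imageE[OF finB[OF that] inj_on_id2, of "u l"] by metis
  qed
  then obtain c where c: "\<And>l i. l < M \<Longrightarrow> i < n \<Longrightarrow> u l $ i = (\<Sum>b\<in>B l. c l b * b $ i)"
    by metis
  have "\<forall>d\<in>D. (case d of (l, b) \<Rightarrow> c l b) = 0"
  proof (rule indep, intro allI impI)
    fix i assume "i < n"
    have "(\<Sum>d\<in>D. (case d of (l, b) \<Rightarrow> c l b) * snd d $ i) = (\<Sum>l<M. \<Sum>b\<in>B l. c l b * b $ i)"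
      unfolding D_def using finB by (subst sum.Sigma) (auto intro: sum.cong)
    also have "\<dots> = (\<Sum>l<M. u l $ i)" using c \<open>i < n\<close> by simp
    finally show "(\<Sum>d\<in>D. (case d of (l, b) \<Rightarrow> c l b) * snd d $ i) = 0" using sum \<open>i < n\<close> by simp
  qed
  then have "c l b = 0" if "b \<in> B l" for b
    using bspec[of D _ "(l, b)"] that l by (simp add: D_def)
  then have "u l $ i = 0" if "i < n" for i using c[OF l that] by simp
  moreover have "u l \<in> carrier_vec n" using u[OF l] car[OF l] by blast
  ultimately show ?thesis by (intro eq_vecI) auto
qed

end

lemma independent_subspacesD:
  fixes S :: "nat \<Rightarrow> 'a::field vec set" and u :: "nat \<Rightarrow> 'a vec"
  assumes "independent_subspaces m M S" "\<forall>l<M. lin_subspace m (S l)"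
    and "\<And>l. l < M \<Longrightarrow> u l \<in> S l" "\<And>i. i < m \<Longrightarrow> (\<Sum>l<M. u l $ i) = 0" "l < M"
  shows "u l = 0\<^sub>v m"
  by (rule vec_space.direct_sum_of_dim[of M S m u l])
    (use assms in \<open>auto simp: independent_subspaces_def lin_subspace_def sub_dim_def\<close>)

section \<open>Submatrices of full rank\<close>

text \<open>A maximal independent set of columns of the submatrix has rank \<open>A\<close> many
  members. A relation among the same columns of \<open>A\<close> restricts to the chosen rows, so
  these columns are independent too, and by their number they span all columns.\<close>

lemma submatrix_full_rank_columns:
  fixes A :: "'a::field mat"
  assumes A: "A \<in> carrier_mat m n"
    and q: "\<And>i. i < s \<Longrightarrow> q i < m" and p: "\<And>j. j < k \<Longrightarrow> p j < n"
    and rank: "vec_space.rank s (mat s k (\<lambda>(i, j). A $$ (q i, p j))) = vec_space.rank m A"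
  shows "\<exists>D\<subseteq>{..<k}.
    (\<forall>c. (\<forall>i<s. (\<Sum>d\<in>D. c d * A $$ (q i, p d)) = 0) \<longrightarrow> (\<forall>d\<in>D. c d = 0)) \<and>
    (\<forall>j<n. \<exists>c. \<forall>i<m. A $$ (i, j) = (\<Sum>d\<in>D. c d * A $$ (i, p d)))"
proof -
  define U where "U = mat s k (\<lambda>(i, j). A $$ (q i, p j))"
  have U: "U \<in> carrier_mat s k" by (simp add: U_def)
  interpret U: vec_space "TYPE('a)" s .
  interpret V: vec_space "TYPE('a)" m .
  obtain T where T: "maximal T (\<lambda>T. T \<subseteq> set (cols U) \<and> U.lin_indpt T)"
    using maximal_exists_superset[of "set (cols U)" "\<lambda>T. T \<subseteq> set (cols U) \<and> U.lin_indpt T" "{}"]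
    by (auto simp: U.lin_dep_def)
  have colsU: "set (cols U) = col U ` {..<k}" using U by (auto simp: cols_def)
  have "T \<subseteq> col U ` {..<k}" using T colsU by (simp add: maximal_def)
  then obtain D where D: "D \<subseteq> {..<k}" "inj_on (col U) D" "T = col U ` D"
    by (auto simp: subset_image_inj)
  have finD: "finite D" using D(1) finite_subset by blast
  have cardD: "card D = V.rank A"
    using U.rank_card_indpt[OF U T] rank D by (simp add: U_def card_image)
  have colU: "col U d $ i = A $$ (q i, p d)" if "d \<in> D" "i < s" for d i
    using that D(1) by (auto simp: U_def)
  have colA: "col A (p d) $ i = A $$ (i, p d)" if "d \<in> D" "i < m" for d i
    using that D(1) p[of d] A by auto
  have colUc: "col U ` D \<subseteq> carrier_vec s" using U by auto
  have li: "U.lin_indpt (col U ` D)" using T D by (simp add: maximal_def)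
  have indep: "\<forall>d\<in>D. c d = 0" if "\<forall>i<s. (\<Sum>d\<in>D. c d * A $$ (q i, p d)) = 0" for c
  proof (rule U.lin_indpt_image_iff[OF finD D(2) colUc, THEN iffD1, OF li, THEN spec, THEN mp], intro allI impI)
    fix i assume "i < s"
    then show "(\<Sum>d\<in>D. c d * col U d $ i) = 0" using that by (simp add: colU)
  qed
  let ?v = "\<lambda>d. col A (p d)"
  have inj: "inj_on ?v D"
  proof (rule inj_onI)
    fix d e assume de: "d \<in> D" "e \<in> D" "?v d = ?v e"
    have "col U d = col U e"
    proof (rule eq_vecI)
      fix i assume "i < dim_vec (col U e)"
      then have "i < s" using U by simp
      then show "col U d $ i = col U e $ i"
        using colU[OF de(1)] colU[OF de(2)] colA[OF de(1) q] colA[OF de(2) q] de(3) by simp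
    qed (use U in simp)
    then show "d = e" using D(2) de by (meson inj_onD)
  qed
  have vc: "?v ` D \<subseteq> carrier_vec m" using A by auto
  have liA: "V.lin_indpt (?v ` D)"
  proof (rule V.lin_indpt_image_iff[OF finD inj vc, THEN iffD2], intro allI impI)
    fix c assume c: "\<forall>i<m. (\<Sum>d\<in>D. c d * col A (p d) $ i) = 0"
    show "\<forall>d\<in>D. c d = 0"
    proof (rule indep, intro allI impI)
      fix i assume "i < s"
      then show "(\<Sum>d\<in>D. c d * A $$ (q i, p d)) = 0"
        using c[rule_format, OF q] by (simp add: colA[OF _ q])
    qed
  qed
  have vcols: "?v ` D \<subseteq> set (cols A)"
    using D(1) p A by (auto simp: cols_def)
  have span: "col A j \<in> V.span (?v ` D)" if j: "j < n" for j
  proof (rule ccontr)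
    assume not: "col A j \<notin> V.span (?v ` D)"
    then have nin: "col A j \<notin> ?v ` D" using V.in_own_span[of "?v ` D"] vc by auto
    have "V.lin_indpt (?v ` D \<union> {col A j})"
      using V.lin_dep_iff_in_span[OF _ liA _ nin] vc A not by auto
    moreover have "?v ` D \<union> {col A j} \<subseteq> set (cols A)" using vcols j A by (auto simp: cols_def)
    ultimately have "card (?v ` D \<union> {col A j}) \<le> V.rank A" using V.rank_ge_card_indpt[OF A] by blast
    then show False using nin finD inj cardD by (simp add: card_image)
  qed
  show ?thesis
  proof (intro exI[of _ D] conjI D(1) allI impI)
    show "\<forall>d\<in>D. c d = 0" if "\<forall>i<s. (\<Sum>d\<in>D. c d * A $$ (q i, p d)) = 0" for c
      using that by (rule indep)
    fix j assume j: "j < n"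
    obtain c where "\<And>i. i < m \<Longrightarrow> col A j $ i = (\<Sum>d\<in>D. c d * ?v d $ i)"
      using V.span_imageE[OF finD inj vc span[OF j]] by blast
    then show "\<exists>c. \<forall>i<m. A $$ (i, j) = (\<Sum>d\<in>D. c d * A $$ (i, p d))"
      using A j colA by (intro exI[of _ c]) (auto cong: sum.cong)
  qed
qed

text \<open>Every column of \<open>A\<close> is expanded in the columns \<open>D\<close> of the
  previous lemma; these coefficients, padded with zeros, form \<open>Z\<close>. A combination of
  selected columns becomes one of the \<open>D\<close> columns with coefficients \<open>e\<close>;
  vanishing on the rows \<open>q\<close> forces \<open>e = 0\<close>, hence vanishing on all
  rows.\<close>

lemma submatrix_full_rank:
  fixes A :: "'a::field mat"
  assumes A: "A \<in> carrier_mat m n"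
    and q: "\<And>i. i < s \<Longrightarrow> q i < m" and p: "\<And>j. j < k \<Longrightarrow> p j < n"
    and rank: "vec_space.rank s (mat s k (\<lambda>(i, j). A $$ (q i, p j))) = vec_space.rank m A"
  shows submatrix_full_rank_factor:
      "\<exists>Z\<in>carrier_mat k n. A = mat m k (\<lambda>(i, j). A $$ (i, p j)) * Z"
    and submatrix_full_rank_kernel:
      "\<And>x. \<forall>i<s. (\<Sum>j<k. A $$ (q i, p j) * x j) = 0 \<Longrightarrow> i < m \<Longrightarrow> (\<Sum>j<k. A $$ (i, p j) * x j) = 0"
proof -
  obtain D where D: "D \<subseteq> {..<k}"
    and indep: "\<And>c. \<forall>i<s. (\<Sum>d\<in>D. c d * A $$ (q i, p d)) = 0 \<Longrightarrow> \<forall>d\<in>D. c d = 0"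
    and span: "\<And>j. j < n \<Longrightarrow> \<exists>c. \<forall>i<m. A $$ (i, j) = (\<Sum>d\<in>D. c d * A $$ (i, p d))"
    using submatrix_full_rank_columns[OF assms] by auto
  have finD: "finite D" using D finite_subset by blast
  from span obtain c where c: "\<And>j i. j < n \<Longrightarrow> i < m \<Longrightarrow> A $$ (i, j) = (\<Sum>d\<in>D. c j d * A $$ (i, p d))"
    by metis
  define Z where "Z = mat k n (\<lambda>(d, j). if d \<in> D then c j d else 0)"
  have "A = mat m k (\<lambda>(i, j). A $$ (i, p j)) * Z"
  proof (rule eq_matI)
    fix i j assume "i < dim_row (mat m k (\<lambda>(i, j). A $$ (i, p j)) * Z)"
      "j < dim_col (mat m k (\<lambda>(i, j). A $$ (i, p j)) * Z)"
    then have ij: "i < m" "j < n" by (simp_all add: Z_def)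
    have "(mat m k (\<lambda>(i, j). A $$ (i, p j)) * Z) $$ (i, j)
        = (\<Sum>d<k. if d \<in> D then c j d * A $$ (i, p d) else 0)"
      using ij by (auto simp: scalar_prod_def Z_def lessThan_atLeast0 intro!: sum.cong)
    also have "\<dots> = (\<Sum>d\<in>D. c j d * A $$ (i, p d))"
      using D by (simp add: sum.If_cases Int_absorb1)
    finally show "A $$ (i, j) = (mat m k (\<lambda>(i, j). A $$ (i, p j)) * Z) $$ (i, j)" using c ij by simp
  qed (use A in \<open>simp_all add: Z_def\<close>)
  then show "\<exists>Z\<in>carrier_mat k n. A = mat m k (\<lambda>(i, j). A $$ (i, p j)) * Z"
    by (intro bexI[of _ Z]) (simp_all add: Z_def)
  fix x i assume x: "\<forall>i<s. (\<Sum>j<k. A $$ (q i, p j) * x j) = 0" and i: "i < m"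
  define e where "e d = (\<Sum>j<k. x j * c (p j) d)" for d
  have e: "(\<Sum>j<k. A $$ (i, p j) * x j) = (\<Sum>d\<in>D. e d * A $$ (i, p d))" if "i < m" for i
  proof -
    have "(\<Sum>j<k. A $$ (i, p j) * x j) = (\<Sum>j<k. \<Sum>d\<in>D. x j * c (p j) d * A $$ (i, p d))"
    proof (rule sum.cong)
      fix j assume "j \<in> {..<k}"
      then have "A $$ (i, p j) = (\<Sum>d\<in>D. c (p j) d * A $$ (i, p d))" using c p that by simp
      then have "A $$ (i, p j) * x j = (\<Sum>d\<in>D. c (p j) d * A $$ (i, p d)) * x j" by (rule arg_cong)
      then show "A $$ (i, p j) * x j = (\<Sum>d\<in>D. x j * c (p j) d * A $$ (i, p d))"
        by (simp only: sum_distrib_left sum_distrib_right mult_ac)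
    qed simp
    also have "\<dots> = (\<Sum>d\<in>D. e d * A $$ (i, p d))"
      unfolding e_def sum_distrib_right by (rule sum.swap)
    finally show ?thesis .
  qed
  have "\<forall>d\<in>D. e d = 0" by (rule indep) (use x e q in auto)
  then show "(\<Sum>j<k. A $$ (i, p j) * x j) = 0" using e[OF i] by simp
qed

subsection \<open>Connectivity of generic Gram matrices\<close>

text \<open>The reached sets gain an index at every step until they have \<open>d\<close> members,
  which takes at most \<open>d - 1\<close> steps. The last step leads to \<open>j\<close>, since
  \<open>d\<close> reached vectors span \<open>y j\<close>.\<close>

lemma generic_gram_connected:
  fixes y :: "'i \<Rightarrow> nat \<Rightarrow> 'a::rc_field" and k :: nat and T :: "'i set"
  defines "g \<equiv> \<lambda>a b. \<Sum>p<k. conjugate (y a p) * y b p"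
  defines "E \<equiv> {(a, b). a \<in> T \<and> b \<in> T \<and> g a b \<noteq> 0}"
  assumes T: "finite T"
    and d: "0 < d" "d < card T"
    and indep: "\<And>A c. A \<subseteq> T \<Longrightarrow> card A = d \<Longrightarrow> \<forall>p<k. (\<Sum>a\<in>A. c a * y a p) = 0 \<Longrightarrow> \<forall>a\<in>A. c a = 0"
    and span: "\<And>A b. A \<subseteq> T \<Longrightarrow> card A = d \<Longrightarrow> b \<in> T \<Longrightarrow> \<exists>c. \<forall>p<k. y b p = (\<Sum>a\<in>A. c a * y a p)"
    and i: "i \<in> T" and j: "j \<in> T"
  shows "(i, j) \<in> E ^^ d"
proof -
  \<comment> \<open>Smaller index sets are enlarged to size \<open>d\<close>, with zero coefficients
    on the new indices.\<close>
  have indep_le: "\<forall>a\<in>A. c a = 0"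
    if A: "A \<subseteq> T" "card A \<le> d" and z: "\<forall>p<k. (\<Sum>a\<in>A. c a * y a p) = 0" for A c
  proof -
    have "\<exists>B. A \<subseteq> B \<and> B \<subseteq> T \<and> card B = d"
      using A T d by (intro exists_subset_between) auto
    then obtain B where B: "A \<subseteq> B" "B \<subseteq> T" "card B = d" by blast
    have finB: "finite B" using B(2) T finite_subset by blast
    have "(\<Sum>a\<in>B. (if a \<in> A then c a else 0) * y a p) = (\<Sum>a\<in>A. c a * y a p)" for p
      by (rule sum.mono_neutral_cong_right) (use B finB in auto)
    then have "\<forall>p<k. (\<Sum>a\<in>B. (if a \<in> A then c a else 0) * y a p) = 0" using z by simp
    note zero = indep[OF B(2,3) this]
    show ?thesis
    proof
      fix a assume "a \<in> A"
      then show "c a = 0" using bspec[OF zero, of a] B(1) by auto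
    qed
  qed
  have g_sum: "g a b = (\<Sum>x\<in>A. c x * g a x)" if "\<forall>p<k. y b p = (\<Sum>x\<in>A. c x * y x p)" for a b c A
  proof -
    have "g a b = (\<Sum>p<k. \<Sum>x\<in>A. c x * (conjugate (y a p) * y x p))"
      unfolding g_def using that by (intro sum.cong) (simp_all add: sum_distrib_left mult_ac)
    also have "\<dots> = (\<Sum>x\<in>A. c x * g a x)"
      unfolding g_def sum_distrib_left by (rule sum.swap)
    finally show ?thesis .
  qed
  have g_self: "g a a \<noteq> 0" if "a \<in> T" for a
  proof
    assume "g a a = 0"
    then have "\<forall>p<k. y a p = 0"
      unfolding g_def by (subst (asm) sum_conjugate_mult_self_eq_0_iff) auto
    then have "\<forall>p<k. (\<Sum>b\<in>{a}. 1 * y b p) = 0" by simp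
    from indep_le[OF _ _ this] that d show False by auto
  qed
  define N where "N t = (E ^^ t) `` {i}" for t
  have N0: "N 0 = {i}" by (simp add: N_def)
  have NS: "N (Suc t) = E `` N t" for t by (auto simp: N_def)
  have NT: "N t \<subseteq> T" for t
    by (cases t) (use i N0 NS in \<open>auto simp: E_def\<close>)
  have finN: "finite (N t)" for t using NT T finite_subset by blast
  have mono: "N t \<subseteq> N (Suc t)" for t
    using NT g_self by (auto simp: NS E_def)
  have card: "min (Suc t) d \<le> card (N t)" for t
  proof (induction t)
    case 0
    then show ?case by (simp add: N0)
  next
    case (Suc t)
    have le: "card (N t) \<le> card (N (Suc t))" using mono finN by (intro card_mono) auto
    show ?case
    proof (cases "d \<le> card (N t) \<or> N t \<noteq> N (Suc t)")
      case True
      then show ?thesis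
      proof
        assume "N t \<noteq> N (Suc t)"
        then have "card (N t) < card (N (Suc t))" using mono finN by (intro psubset_card_mono) auto
        then show ?thesis using Suc by simp
      qed (use le in simp)
    next
      case False
      then have small: "card (N t) < d" and closed: "E `` N t = N t" using NS by auto
      have orth: "g a b = 0" if "a \<in> N t" "b \<in> T - N t" for a b
      proof (rule ccontr)
        assume "g a b \<noteq> 0"
        then have "b \<in> E `` N t" using that NT by (auto simp: E_def)
        then show False using that closed by blast
      qed
      \<comment> \<open>Here \<open>d < card T\<close> provides one vector more than the dimension
        of the orthogonal complement.\<close>
      have "Suc (d - card (N t)) \<le> card (T - N t)"
        using d small finN NT by (simp add: card_Diff_subset)
      then obtain A where A: "A \<subseteq> T - N t" "card A = Suc (d - card (N t))"
        by (meson obtain_subset_with_card_n)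
      have finA: "finite A" using A(1) T finite_subset by blast
      have "A \<noteq> {}" using A(2) by auto
      then obtain a where a: "a \<in> A" by blast
      \<comment> \<open>One vector is removed so that \<open>N t \<union> B\<close> has exactly
        \<open>d\<close> members and therefore spans \<open>y a\<close>.\<close>
      define B where "B = A - {a}"
      have finB: "finite B" and cardB: "card B = d - card (N t)" and BA: "B \<subseteq> T - N t"
        using finA A a by (auto simp: B_def)
      have aT: "a \<in> T" using a A by auto
      have "card (N t \<union> B) = d"
        using finN finB BA cardB small by (subst card_Un_disjoint) auto
      moreover have "N t \<union> B \<subseteq> T" using NT BA by auto
      ultimately obtain c where c: "\<forall>p<k. y a p = (\<Sum>x\<in>N t \<union> B. c x * y x p)"
        using span[OF _ _ aT] by blast
      define u where "u p = (\<Sum>x\<in>N t. c x * y x p)" for p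
      have split: "y a p = u p + (\<Sum>x\<in>B. c x * y x p)" if "p < k" for p
        using c that finN finB BA unfolding u_def by (subst sum.union_disjoint[symmetric]) auto
      \<comment> \<open>The component of \<open>y a\<close> in the span of \<open>N t\<close> is orthogonal to \<open>N t\<close>, hence it vanishes.\<close>
      have ux: "(\<Sum>p<k. conjugate (y x p) * u p) = 0" if x: "x \<in> N t" for x
      proof -
        have "u p = y a p - (\<Sum>b\<in>B. c b * y b p)" if "p < k" for p using split[OF that] by simp
        then have "(\<Sum>p<k. conjugate (y x p) * u p)
            = (\<Sum>p<k. conjugate (y x p) * y a p - conjugate (y x p) * (\<Sum>b\<in>B. c b * y b p))"
          by (intro sum.cong) (simp_all add: right_diff_distrib)
        also have "\<dots> = g x a - (\<Sum>p<k. \<Sum>b\<in>B. c b * (conjugate (y x p) * y b p))"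
          unfolding sum_subtractf g_def sum_distrib_left by (simp only: mult_ac)
        also have "(\<Sum>p<k. \<Sum>b\<in>B. c b * (conjugate (y x p) * y b p)) = (\<Sum>b\<in>B. c b * g x b)"
          unfolding g_def sum_distrib_left by (rule sum.swap)
        also have "\<dots> = 0" using orth[OF x] BA by (intro sum.neutral) auto
        also have "g x a = 0" using orth[OF x] a A by auto
        finally show ?thesis by simp
      qed
      have "(\<Sum>p<k. conjugate (u p) * u p) = (\<Sum>p<k. \<Sum>x\<in>N t. conjugate (c x) * (conjugate (y x p) * u p))"
        unfolding u_def[of "_ :: nat"]
        by (rule sum.cong)
          (simp_all add: sum_conjugate[OF finN] conjugate_dist_mul sum_distrib_right mult.assoc)
      also have "\<dots> = (\<Sum>x\<in>N t. conjugate (c x) * (\<Sum>p<k. conjugate (y x p) * u p))"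
        unfolding sum_distrib_left by (rule sum.swap)
      also have "\<dots> = 0" using ux by simp
      finally have "\<forall>p<k. u p = 0" by (subst (asm) sum_conjugate_mult_self_eq_0_iff) auto
      then have ya: "y a p = (\<Sum>x\<in>B. c x * y x p)" if "p < k" for p using split that by simp
      have "\<forall>p<k. (\<Sum>x\<in>A. (if x = a then - 1 else c x) * y x p) = 0"
      proof (intro allI impI)
        fix p assume "p < k"
        have "(\<Sum>x\<in>A. (if x = a then - 1 else c x) * y x p)
            = - y a p + (\<Sum>x\<in>B. (if x = a then - 1 else c x) * y x p)"
          using finA a by (simp add: B_def sum.remove[of A a])
        also have "(\<Sum>x\<in>B. (if x = a then - 1 else c x) * y x p) = (\<Sum>x\<in>B. c x * y x p)"
          by (rule sum.cong) (auto simp: B_def)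
        finally show "(\<Sum>x\<in>A. (if x = a then - 1 else c x) * y x p) = 0" using ya[OF \<open>p < k\<close>] by simp
      qed
      \<comment> \<open>\<open>A\<close> has \<open>d - card (N t) + 1\<close> members; that
        \<open>N t\<close> is nonempty brings this down to at most \<open>d\<close>, so independence
        applies to \<open>A\<close>.\<close>
      moreover have "0 < card (N t)"
        using Suc d by (cases "card (N t)") auto
      then have "card A \<le> d" using A(2) small by simp
      moreover have "A \<subseteq> T" using A(1) by blast
      ultimately have "\<forall>x\<in>A. (if x = a then - 1 else c x) = 0" by (intro indep_le)
      then show ?thesis using a by auto
    qed
  qed
  obtain t where t: "d = Suc t" using d by (cases d) auto
  have "d \<le> card (N t)" using card[of t] t by simp
  then obtain A where A: "A \<subseteq> N t" "card A = d" by (meson obtain_subset_with_card_n)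
  \<comment> \<open>\<open>y j\<close> is a combination of the vectors in \<open>A\<close>;
    orthogonal to all of them, it would be orthogonal to itself.\<close>
  have "\<exists>a\<in>A. g j a \<noteq> 0"
  proof (rule ccontr)
    assume not: "\<not> (\<exists>a\<in>A. g j a \<noteq> 0)"
    obtain c where "\<forall>p<k. y j p = (\<Sum>a\<in>A. c a * y a p)" using span[of A j] A NT j by blast
    from g_sum[OF this] not have "g j j = 0" by simp
    then show False using g_self[OF j] by simp
  qed
  then obtain a where a: "a \<in> A" "g j a \<noteq> 0" by blast
  have "conjugate (g j a) = g a j"
    unfolding g_def by (simp add: sum_conjugate conjugate_dist_mul mult.commute)
  then have "g a j \<noteq> 0" using a(2) by (metis conjugate_zero_iff)
  then have "j \<in> N (Suc t)" using a A NT j by (auto simp: NS E_def)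
  then show ?thesis by (simp add: N_def t)
qed

subsection \<open>Block structure and powers\<close>

text \<open>The partial sums over the blocks lie in the respective \<open>S l\<close> and add up to
  zero, so independence kills each of them. The index type is arbitrary, so that a vector may occur
  repeatedly.\<close>

lemma independent_subspaces_relation:
  fixes S :: "nat \<Rightarrow> 'a::field vec set" and w :: "'b \<Rightarrow> 'a vec"
  assumes ind: "independent_subspaces m M S" and S: "\<forall>l<M. lin_subspace m (S l)"
    and A: "finite A" and \<kappa>: "\<And>a. a \<in> A \<Longrightarrow> \<kappa> a < M \<and> w a \<in> S (\<kappa> a)"
    and rel: "\<And>i. i < m \<Longrightarrow> (\<Sum>a\<in>A. c a * w a $ i) = 0"
    and l: "l < M" and i: "i < m"
  shows "(\<Sum>a\<in>{a\<in>A. \<kappa> a = l}. c a * w a $ i) = 0"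
proof -
  define u where "u l = vec m (\<lambda>i. \<Sum>a\<in>{a\<in>A. \<kappa> a = l}. c a * w a $ i)" for l
  have "u l = 0\<^sub>v m"
  proof (rule independent_subspacesD[OF ind S _ _ l])
    fix l assume l: "l < M"
    show "u l \<in> S l"
      unfolding u_def using S l A \<kappa>
      by (intro vec_space.subspace_sum_closed) (auto simp: lin_subspace_def)
  next
    fix i assume "i < m"
    then have "(\<Sum>l<M. u l $ i) = (\<Sum>l<M. \<Sum>a\<in>{a\<in>A. \<kappa> a = l}. c a * w a $ i)"
      by (simp add: u_def)
    also have "\<dots> = (\<Sum>a\<in>A. c a * w a $ i)"
      using A \<kappa> by (intro sum.group) auto
    finally show "(\<Sum>l<M. u l $ i) = 0" using rel \<open>i < m\<close> by simp
  qed
  then have "u l $ i = 0" using i by simp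
  then show ?thesis using i by (simp add: u_def)
qed

section \<open>Columns of Y as coordinates\<close>

text \<open>Writing W = C Z gives R = U Z and Y = (pinv U) U Z, where (pinv U) U is the orthogonal
  projection along ker U = ker C. So C Y = C Z = W and Y is orthogonal to ker C. Relations among
  columns of W pass to R and from there to Y.\<close>

lemma pinv_coordinates:
  fixes W :: "'a::rc_field mat"
  assumes W: "W \<in> carrier_mat m n"
    and q: "\<And>i. i < s \<Longrightarrow> q i < m" and p: "\<And>j. j < k \<Longrightarrow> p j < n"
    and U: "U = mat s k (\<lambda>(i, j). W $$ (q i, p j))" and R: "R = mat s n (\<lambda>(i, j). W $$ (q i, j))"
    and rank: "vec_space.rank s U = vec_space.rank m W"
  defines "Y \<equiv> pinv U * R"
  shows pinv_coordinates_dim: "Y \<in> carrier_mat k n"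
    and pinv_coordinates_eq:
      "\<And>i j. i < m \<Longrightarrow> j < n \<Longrightarrow> W $$ (i, j) = (\<Sum>a<k. Y $$ (a, j) * W $$ (i, p a))"
    and pinv_coordinates_orthogonal:
      "\<And>z j. \<forall>i<m. (\<Sum>a<k. z a * W $$ (i, p a)) = 0 \<Longrightarrow> j < n \<Longrightarrow>
        (\<Sum>a<k. conjugate (z a) * Y $$ (a, j)) = 0"
    and pinv_coordinates_relation:
      "\<And>A c a. A \<subseteq> {..<n} \<Longrightarrow> \<forall>i<m. (\<Sum>j\<in>A. c j * W $$ (i, j)) = 0 \<Longrightarrow> a < k \<Longrightarrow>
        (\<Sum>j\<in>A. c j * Y $$ (a, j)) = 0"
proof -
  define X where "X = pinv U"
  have Uc: "U \<in> carrier_mat s k" and Rc: "R \<in> carrier_mat s n" by (simp_all add: U R)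
  have X: "X \<in> carrier_mat k s" and UXU: "U * X * U = U" and XU: "mat_adjoint (X * U) = X * U"
    using is_pinv_pinv[of U] Uc unfolding X_def is_pinv_def by auto
  have Y: "Y = X * R" by (simp add: Y_def X_def)
  show Yc: "Y \<in> carrier_mat k n" unfolding Y by (rule mult_carrier_mat[OF X Rc])
  obtain Z where Z: "Z \<in> carrier_mat k n" and WZ: "W = mat m k (\<lambda>(i, j). W $$ (i, p j)) * Z"
    using submatrix_full_rank_factor[OF W q p rank[unfolded U]] by blast
  have WZ': "W $$ (i, j) = (\<Sum>a<k. W $$ (i, p a) * Z $$ (a, j))" if "i < m" "j < n" for i j
  proof -
    have "W $$ (i, j) = (mat m k (\<lambda>(i, j). W $$ (i, p j)) * Z) $$ (i, j)" using WZ by (rule arg_cong)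
    also have "\<dots> = (\<Sum>a<k. W $$ (i, p a) * Z $$ (a, j))"
      using that Z by (simp add: scalar_prod_def lessThan_atLeast0)
    finally show ?thesis .
  qed
  have RUZ: "R = U * Z"
  proof (rule eq_matI)
    fix i j assume "i < dim_row (U * Z)" "j < dim_col (U * Z)"
    then have "i < s" "j < n" using Uc Z by simp_all
    then show "R $$ (i, j) = (U * Z) $$ (i, j)"
      using Z WZ'[OF q] by (simp add: U R scalar_prod_def lessThan_atLeast0)
  qed (use Uc Rc Z in simp_all)
  have YZ: "Y = X * U * Z" unfolding Y RUZ by (rule assoc_mult_mat[OF X Uc Z, symmetric])
  have XUc: "X * U \<in> carrier_mat k k" by (rule mult_carrier_mat[OF X Uc])
  have UY: "U * Y = U * Z"
  proof -
    have "U * (X * U * Z) = U * (X * U) * Z" by (rule assoc_mult_mat[OF Uc XUc Z, symmetric])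
    also have "U * (X * U) = U" using UXU assoc_mult_mat[OF Uc X Uc] by simp
    finally show ?thesis unfolding YZ .
  qed
  show "W $$ (i, j) = (\<Sum>a<k. Y $$ (a, j) * W $$ (i, p a))" if ij: "i < m" "j < n" for i j
  proof -
    \<comment> \<open>The columns of \<open>Y\<close> and \<open>Z\<close> differ by elements of ker
      U, which is also the kernel of the selected full columns.\<close>
    have "(\<Sum>a<k. W $$ (i, p a) * (Y $$ (a, j) - Z $$ (a, j))) = 0"
    proof (rule submatrix_full_rank_kernel[OF W q p rank[unfolded U] _ ij(1)], assumption, assumption, intro allI impI)
      fix i assume i: "i < s"
      have "(U * Y) $$ (i, j) = (U * Z) $$ (i, j)" by (simp only: UY)
      then show "(\<Sum>a<k. W $$ (q i, p a) * (Y $$ (a, j) - Z $$ (a, j))) = 0"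
        using i ij(2) Uc Yc Z
        by (simp add: U scalar_prod_def lessThan_atLeast0 right_diff_distrib sum_subtractf)
    qed
    then show ?thesis using WZ'[OF ij] by (simp add: right_diff_distrib sum_subtractf mult.commute)
  qed
  show "(\<Sum>a<k. conjugate (z a) * Y $$ (a, j)) = 0"
    if z: "\<forall>i<m. (\<Sum>a<k. z a * W $$ (i, p a)) = 0" and j: "j < n" for z j
  proof -
    define V where "V = mat k 1 (\<lambda>(a, b). z a)"
    have V: "V \<in> carrier_mat k 1" by (simp add: V_def)
    have "U * V = 0\<^sub>m s 1"
    proof (rule eq_matI)
      fix i b assume "i < dim_row (0\<^sub>m s 1 :: 'a mat)" "b < dim_col (0\<^sub>m s 1 :: 'a mat)"
      then have "i < s" "b = 0" by simp_all
      then show "(U * V) $$ (i, b) = 0\<^sub>m s 1 $$ (i, b)"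
        using z[rule_format, OF q] by (simp add: U V_def scalar_prod_def lessThan_atLeast0 mult.commute)
    qed (use Uc V in simp_all)
    then have "X * U * V = 0\<^sub>m k 1"
      using assoc_mult_mat[OF X Uc V] right_mult_zero_mat[OF X] by simp
    moreover have "mat_adjoint V * Y = mat_adjoint V * (X * U) * Z"
      unfolding YZ by (rule assoc_mult_mat[OF mat_adjoint_carrier[OF V] XUc Z, symmetric])
    \<comment> \<open>Self-adjointness of \<open>X * U\<close> moves it onto \<open>V\<close>, which
      it annihilates because \<open>U * V = 0\<close>.\<close>
    moreover have "mat_adjoint V * (X * U) = mat_adjoint (X * U * V)"
      using XU by (subst mat_adjoint_mult) (use V Uc in simp_all)
    ultimately have VY: "mat_adjoint V * Y = mat_adjoint (0\<^sub>m k 1) * Z" by simp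
    have "(mat_adjoint V * Y) $$ (0, j) = (\<Sum>a<k. conjugate (z a) * Y $$ (a, j))"
      using Yc j by (simp add: V_def scalar_prod_def lessThan_atLeast0)
    moreover have "(mat_adjoint (0\<^sub>m k 1) * Z) $$ (0, j) = 0"
      using Z j by (simp add: scalar_prod_def)
    ultimately show ?thesis using VY by simp
  qed
  show "(\<Sum>j\<in>A. c j * Y $$ (a, j)) = 0"
    if A: "A \<subseteq> {..<n}" and c: "\<forall>i<m. (\<Sum>j\<in>A. c j * W $$ (i, j)) = 0" and a: "a < k" for A c a
  proof -
    have "Y $$ (a, j) = (\<Sum>i<s. X $$ (a, i) * W $$ (q i, j))" if "j < n" for j
      using a that X by (simp add: Y R scalar_prod_def lessThan_atLeast0)
    then have "(\<Sum>j\<in>A. c j * Y $$ (a, j)) = (\<Sum>j\<in>A. \<Sum>i<s. X $$ (a, i) * (c j * W $$ (q i, j)))"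
      using A by (intro sum.cong) (auto simp: sum_distrib_left mult_ac)
    also have "\<dots> = (\<Sum>i<s. X $$ (a, i) * (\<Sum>j\<in>A. c j * W $$ (q i, j)))"
      unfolding sum_distrib_left by (rule sum.swap)
    also have "\<dots> = 0" using c q by simp
    finally show ?thesis .
  qed
qed

section \<open>Powers of nonnegative matrices\<close>

text \<open>An entry of the power sums the weights of all walks of length \<open>t\<close>, and
  nonnegative weights cannot cancel. The real witness \<open>h\<close> carries the order that the
  field itself may lack.\<close>

lemma pow_mat_of_real_nonneg:
  fixes q :: "nat \<Rightarrow> nat \<Rightarrow> real" and n :: nat
  defines "E \<equiv> {(i, j). i < n \<and> j < n \<and> q i j \<noteq> 0}"
  assumes q: "\<And>i j. 0 \<le> q i j"
  shows "\<exists>h. mat n n (\<lambda>(i, j). of_real (q i j) :: 'a::real_normed_field) ^\<^sub>m t = mat n n (\<lambda>(i, j). of_real (h i j)) \<and>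
    (\<forall>i<n. \<forall>j<n. 0 \<le> h i j \<and> (h i j \<noteq> 0 \<longleftrightarrow> (i, j) \<in> E ^^ t))"
proof (induction t)
  case 0
  show ?case
    by (rule exI[of _ "\<lambda>i j. if i = j then 1 else 0"]) (auto intro!: eq_matI)
next
  case (Suc t)
  let ?Q = "mat n n (\<lambda>(i, j). of_real (q i j) :: 'a)"
  obtain h where h: "?Q ^\<^sub>m t = mat n n (\<lambda>(i, j). of_real (h i j))"
    and h0: "\<And>i j. i < n \<Longrightarrow> j < n \<Longrightarrow> 0 \<le> h i j \<and> (h i j \<noteq> 0 \<longleftrightarrow> (i, j) \<in> E ^^ t)"
    using Suc by auto
  define h' where "h' i j = (\<Sum>l<n. h i l * q l j)" for i j
  have "?Q ^\<^sub>m Suc t = mat n n (\<lambda>(i, j). of_real (h' i j))"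
    by (rule eq_matI) (auto simp: h scalar_prod_def h'_def lessThan_atLeast0)
  moreover have "0 \<le> h' i j \<and> (h' i j \<noteq> 0 \<longleftrightarrow> (i, j) \<in> E ^^ Suc t)" if ij: "i < n" "j < n" for i j
  proof -
    have nn: "\<forall>l\<in>{..<n}. 0 \<le> h i l * q l j" using h0 ij q by simp
    have "h' i j \<noteq> 0 \<longleftrightarrow> (\<exists>l<n. h i l \<noteq> 0 \<and> q l j \<noteq> 0)"
      unfolding h'_def using nn by (subst sum_nonneg_eq_0_iff) auto
    also have "\<dots> \<longleftrightarrow> (\<exists>l<n. (i, l) \<in> E ^^ t \<and> (l, j) \<in> E)"
      using h0 ij by (auto simp: E_def)
    also have "\<dots> \<longleftrightarrow> (i, j) \<in> E ^^ Suc t" by (auto simp: E_def)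
    finally have "h' i j \<noteq> 0 \<longleftrightarrow> (i, j) \<in> E ^^ Suc t" .
    moreover have "0 \<le> h' i j" unfolding h'_def using nn by (intro sum_nonneg) auto
    ultimately show ?thesis by blast
  qed
  ultimately show ?case by blast
qed

lemma transpose_pow_mat_symmetric:
  fixes A :: "'a::comm_semiring_1 mat"
  assumes A: "A \<in> carrier_mat n n" and sym: "transpose_mat A = A"
  shows "transpose_mat (A ^\<^sub>m t) = A ^\<^sub>m t"
proof (induction t)
  case (Suc t)
  have At: "A ^\<^sub>m t \<in> carrier_mat n n" using A by (rule pow_carrier_mat)
  have comm: "A * A ^\<^sub>m t = A ^\<^sub>m t * A"
  proof (induction t)
    case (Suc t)
    have "A ^\<^sub>m t \<in> carrier_mat n n" using A by (rule pow_carrier_mat)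
    then show ?case using Suc assoc_mult_mat[OF A _ A, of "A ^\<^sub>m t"] by simp
  qed (use A in simp)
  have "transpose_mat (A ^\<^sub>m t * A) = transpose_mat A * transpose_mat (A ^\<^sub>m t)"
    by (rule transpose_mult[OF At A])
  then show ?case using Suc sym comm by simp
qed simp

text \<open>Reduces the claim to walks in the nonzero pattern of \<open>q\<close>, so that the
  binary matrix and the matrix of absolute values are treated together.\<close>

lemma pow_mat_of_real_similarity:
  fixes W :: "'a::real_normed_field mat" and q :: "nat \<Rightarrow> nat \<Rightarrow> real"
  assumes n: "dim_col W = n" and q: "\<And>i j. 0 \<le> q i j" and sym: "\<And>i j. i < n \<Longrightarrow> j < n \<Longrightarrow> q i j = q j i"
    and Q: "Q = mat n n (\<lambda>(i, j). of_real (q i j))"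
    and conn: "\<And>i j. i < n \<Longrightarrow> j < n \<Longrightarrow>
      (i, j) \<in> {(i, j). i < n \<and> j < n \<and> q i j \<noteq> 0} ^^ t \<longleftrightarrow> (\<exists>l<M. col W i \<in> S l \<and> col W j \<in> S l)"
  shows "similarity_matrix W M S (Q ^\<^sub>m t)"
proof -
  have Qc: "Q \<in> carrier_mat n n" by (simp add: Q)
  obtain h where h: "Q ^\<^sub>m t = mat n n (\<lambda>(i, j). of_real (h i j))"
    and h0: "\<forall>i<n. \<forall>j<n. 0 \<le> h i j \<and>
      (h i j \<noteq> 0 \<longleftrightarrow> (i, j) \<in> {(i, j). i < n \<and> j < n \<and> q i j \<noteq> 0} ^^ t)"
    using pow_mat_of_real_nonneg[of q n t, where 'a='a] q unfolding Q by blast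
  have "transpose_mat Q = Q" using sym by (intro eq_matI) (auto simp: Q)
  then have "transpose_mat (Q ^\<^sub>m t) = Q ^\<^sub>m t" by (rule transpose_pow_mat_symmetric[OF Qc])
  moreover have "Q ^\<^sub>m t \<in> carrier_mat n n" using Qc by (rule pow_carrier_mat)
  moreover have "(Q ^\<^sub>m t) $$ (i, j) \<noteq> 0 \<longleftrightarrow> (\<exists>l<M. col W i \<in> S l \<and> col W j \<in> S l)"
    if ij: "i < n" "j < n" for i j
    using ij h0 conn[OF ij] by (simp add: h)
  ultimately show ?thesis by (simp add: similarity_matrix_def n)
qed

lemma generic_colsD:
  fixes W :: "'a::field mat"
  assumes S: "lin_subspace m S" and gen: "generic_cols m S W T" and W: "W \<in> carrier_mat m n"
    and A: "A \<subseteq> T" "card A = sub_dim m S" and finT: "finite T" and TW: "T \<subseteq> {..<n}"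
  shows generic_cols_indep: "\<And>c. \<forall>i<m. (\<Sum>j\<in>A. c j * W $$ (i, j)) = 0 \<Longrightarrow> \<forall>j\<in>A. c j = 0"
    and generic_cols_span: "\<And>v. v \<in> S \<Longrightarrow> \<exists>c. \<forall>i<m. v $ i = (\<Sum>j\<in>A. c j * W $$ (i, j))"
proof -
  interpret vec_space "TYPE('a)" m .
  have sub: "subspace class_ring S V" using S by (simp add: lin_subspace_def)
  have inj: "inj_on (col W) A" and basis: "vectorspace.basis class_ring (vs S) (col W ` A)"
    using gen A by (simp_all add: generic_cols_def)
  note B = subspace_basisD[OF sub basis]
  have finA: "finite A" using A(1) finT finite_subset by blast
  have car: "col W ` A \<subseteq> carrier_vec m" using W by auto
  have idx: "col W j $ i = W $$ (i, j)" if "i < m" "j \<in> A" for i j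
    using that A(1) TW W by (subst index_col) auto
  show "\<forall>j\<in>A. c j = 0" if c: "\<forall>i<m. (\<Sum>j\<in>A. c j * W $$ (i, j)) = 0" for c
  proof (rule lin_indpt_image_iff[OF finA inj car, THEN iffD1, OF B(1), THEN spec, THEN mp], intro allI impI)
    fix i assume "i < m"
    then show "(\<Sum>j\<in>A. c j * col W j $ i) = 0" using c by (simp add: idx)
  qed
  show "\<exists>c. \<forall>i<m. v $ i = (\<Sum>j\<in>A. c j * W $$ (i, j))" if "v \<in> S" for v
  proof -
    have "v \<in> span (col W ` A)" using that B(2) by simp
    then obtain c where "\<And>i. i < m \<Longrightarrow> v $ i = (\<Sum>j\<in>A. c j * col W j $ i)"
      using span_imageE[OF finA inj car] by blast
    then show ?thesis using idx by (intro exI[of _ c]) (auto cong: sum.cong)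
  qed
qed

text \<open>In dimension zero, genericity would make the empty set of columns a basis, and
  \<open>S\<close> its span.\<close>

lemma generic_cols_dim_pos:
  fixes W :: "'a::field mat"
  assumes S: "lin_subspace m S" and gen: "generic_cols m S W T" and nz: "S \<noteq> {0\<^sub>v m}"
  shows "0 < sub_dim m S"
proof (rule ccontr)
  interpret vec_space "TYPE('a)" m .
  assume "\<not> 0 < sub_dim m S"
  then have "vectorspace.basis class_ring (vs S) (col W ` {})"
    using gen unfolding generic_cols_def by (metis card.empty empty_subsetI not_gr_zero)
  then have "span {} = S" using subspace_basisD(2)[of S "{}"] S by (simp add: lin_subspace_def)
  then show False using nz span_empty by simp
qed

text \<open>The loop at the start is traversed \<open>b - a\<close> times first. This pads walks of
  length \<open>d l\<close> to the common length \<open>dmax\<close>.\<close>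

lemma relpow_mono_refl:
  assumes "(x, x) \<in> E" "(x, y) \<in> E ^^ a" "a \<le> b"
  shows "(x, y) \<in> E ^^ b"
proof -
  have "(x, x) \<in> E ^^ c" for c by (induction c) (use assms(1) in auto)
  then have "(x, y) \<in> E ^^ (b - a) O E ^^ a" using assms(2) by auto
  then show ?thesis using assms(3) by (simp flip: relpow_add)
qed

lemma relpow_mono:
  fixes E F :: "('a \<times> 'a) set"
  assumes "E \<subseteq> F"
  shows "E ^^ t \<subseteq> F ^^ t"
  by (induction t) (simp_all add: relcomp_mono assms)

lemma relpow_invariant: "(x, y) \<in> E ^^ t \<Longrightarrow> (\<And>x y. (x, y) \<in> E \<Longrightarrow> f x = f y) \<Longrightarrow> f x = f y"
  by (induction t arbitrary: y) auto

theorem theorem2: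
  fixes W :: "'a::rc_field mat"
    and S :: "nat \<Rightarrow> 'a vec set"
    and M m n r :: nat
    and I J :: "nat set"
  assumes "M \<ge> 1"
    and "\<forall>l<M. lin_subspace m (S l)"
    and "\<forall>l<M. S l \<noteq> {0\<^sub>v m}"
    and "independent_subspaces m M S"
    and "W \<in> carrier_mat m n"
    and "\<forall>j<n. \<exists>l<M. col W j \<in> S l"
    and "\<forall>l<M. generic_cols m (S l) W {j. j < n \<and> col W j \<in> S l}"
    and "vec_space.rank m W = r"
    and "I \<subseteq> {..<m}" and "J \<subseteq> {..<n}"
    and "vec_space.rank (card I) (submatrix W I J) = r"
  shows "let dmax = Max ((\<lambda>l. sub_dim m (S l)) ` {..<M});
             U = submatrix W I J;
             R = submatrix W I {..<n};
             Y = pinv U * R;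
             G = mat_adjoint Y * Y
         in similarity_matrix W M S (bin_mat G ^\<^sub>m dmax)
          \<and> similarity_matrix W M S (abs_mat G ^\<^sub>m dmax)"
proof -

  \<comment> \<open>Translation of the submatrices into index maps\<close>
  note S = assms(2) and ind = assms(4) and W = assms(5)
  define s k where "s = card I" and "k = card J"
  define q p where "q = pick I" and "p = pick J"
  define U R Y G where "U = submatrix W I J" and "R = submatrix W I {..<n}"
    and "Y = pinv U * R" and "G = mat_adjoint Y * Y"
  define d dmax where "d l = sub_dim m (S l)" and "dmax = Max (d ` {..<M})" for l
  define T where "T l = {j. j < n \<and> col W j \<in> S l}" for l
  have dimW [simp]: "dim_row W = m" "dim_col W = n" using W by auto
  have setI: "{i. i < m \<and> i \<in> I} = I" and setJ: "{j. j < n \<and> j \<in> J} = J"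
    and setn: "{j. j < n \<and> j \<in> {..<n}} = {..<n}"
    using assms(9,10) by auto
  have U: "U = mat s k (\<lambda>(i, j). W $$ (q i, p j))"
    unfolding U_def submatrix_def by (simp add: setI setJ s_def k_def q_def p_def)
  have pick_n: "pick {..<n} j = j" if "j < n" for j
    using pick_reduce_set[of j n UNIV] that by (simp add: pick_UNIV lessThan_def)
  have R: "R = mat s n (\<lambda>(i, j). W $$ (q i, j))"
    unfolding R_def submatrix_def setn by (rule eq_matI) (auto simp: setI s_def q_def pick_n)
  have q: "q i < m" if "i < s" for i
    using pick_le[of i m I] that by (simp add: setI s_def q_def)
  have p: "p j < n" if "j < k" for j
    using pick_le[of j n J] that by (simp add: setJ k_def p_def)
  have rank: "vec_space.rank s U = vec_space.rank m W" using assms(8,11) by (simp add: U_def s_def)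
  note Yc = pinv_coordinates_dim[OF W q p U R rank, folded Y_def]
    and Y_eq = pinv_coordinates_eq[OF W q p U R rank, folded Y_def]
    and Y_orth = pinv_coordinates_orthogonal[OF W q p U R rank, folded Y_def]
    and Y_rel = pinv_coordinates_relation[OF W q p U R rank, folded Y_def]

  \<comment> \<open>The blocks of columns from each subspace\<close>
  have subS: "lin_subspace m (S l)" if "l < M" for l using S that by blast
  have gen: "generic_cols m (S l) W (T l)" if "l < M" for l using assms(7) that by (simp add: T_def)
  have T: "finite (T l)" "T l \<subseteq> {..<n}" for l by (auto simp: T_def)
  have d: "0 < d l" "d l < card (T l)" if "l < M" for l
    using generic_cols_dim_pos[OF subS gen] assms(3) gen[OF that] that by (auto simp: d_def generic_cols_def)
  note W_indep = generic_cols_indep[OF subS gen W _ _ T(1) T(2), folded d_def]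
    and W_span = generic_cols_span[OF subS gen W _ _ T(1) T(2), folded d_def]
  \<comment> \<open>As \<open>d l\<close> is positive, \<open>j\<close> belongs to some
    \<open>d l\<close> indices of the block, whose columns are independent.\<close>
  have nonzero: "\<exists>i<m. W $$ (i, j) \<noteq> 0" if l: "l < M" and j: "j \<in> T l" for l j
  proof (rule ccontr)
    assume "\<not> (\<exists>i<m. W $$ (i, j) \<noteq> 0)"
    obtain A where A: "{j} \<subseteq> A" "A \<subseteq> T l" "card A = d l"
      using exists_subset_between[of "{j}" "d l" "T l"] j d[OF l] T(1) by auto
    have "\<forall>i<m. (\<Sum>a\<in>A. (if a = j then 1 else 0) * W $$ (i, a)) = 0"
      using \<open>\<not> (\<exists>i<m. W $$ (i, j) \<noteq> 0)\<close> by (auto intro!: sum.neutral)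
    from W_indep[OF l l A(2,3) this] A(1) show False by auto
  qed
  have unique: "l = l'" if l: "l < M" "l' < M" "j \<in> T l" "j \<in> T l'" for l l' j
  proof (rule ccontr)
    assume ne: "l \<noteq> l'"
    have jn: "j < n" using l by (simp add: T_def)
    have "W $$ (i, j) = 0" if i: "i < m" for i
    proof -
      \<comment> \<open>The relation is w - w = 0 for the \<open>j\<close>-th column w, with the two
        copies indexed by \<open>bool\<close> and assigned to \<open>l\<close> and
        \<open>l'\<close>.\<close>
      have "(\<Sum>b\<in>{b\<in>UNIV. (if b then l else l') = l}. (if b then 1 else - 1) * col W j $ i) = 0"
        by (rule independent_subspaces_relation[OF ind S _ _ _ l(1) i]) (use l in \<open>auto simp: T_def UNIV_bool\<close>)
      moreover have "{b\<in>UNIV. (if b then l else l') = l} = {True}" using ne by auto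
      ultimately show ?thesis using jn i by simp
    qed
    then show False using nonzero[OF l(1,3)] by blast
  qed
  define \<kappa> where "\<kappa> j = (SOME l. l < M \<and> j \<in> T l)" for j
  have \<kappa>: "\<kappa> j < M \<and> j \<in> T (\<kappa> j)" if "j < n" for j
    unfolding \<kappa>_def by (rule someI_ex) (use assms(6) that in \<open>auto simp: T_def\<close>)
  have \<kappa>_eq: "\<kappa> j = l" if "l < M" "j \<in> T l" for l j
    using unique[of "\<kappa> j" l j] \<kappa>[of j] that by (auto simp: T_def)

  \<comment> \<open>The part of the \<open>j\<close>-th column of \<open>Y\<close> outside the block of \<open>j\<close> is a linear relation
    among the selected columns of \<open>W\<close>, so it is orthogonal to that column, hence to itself.\<close>
  have block: "Y $$ (a, j) = 0" if a: "a < k" and j: "j < n" and ne: "\<kappa> (p a) \<noteq> \<kappa> j" for a j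
  proof -
    define z where "z a = (if \<kappa> (p a) = \<kappa> j then 0 else Y $$ (a, j))" for a
    \<comment> \<open>The extra index \<open>k\<close> stands for column \<open>j\<close> itself
      with coefficient -1, so that \<open>c\<close> encodes the relation C y - w = 0.\<close>
    define p' c where "p' a = (if a < k then p a else j)" and "c a = (if a < k then Y $$ (a, j) else - 1)" for a
    have p': "p' a < n" for a using p j by (simp add: p'_def)
    have rel: "(\<Sum>a\<in>{a\<in>{..k}. \<kappa> (p' a) = l}. c a * W $$ (i, p' a)) = 0" if l: "l < M" and i: "i < m" for l i
    proof -
      have "(\<Sum>a\<in>{a\<in>{..k}. \<kappa> (p' a) = l}. c a * col W (p' a) $ i) = 0"
      proof (rule independent_subspaces_relation[OF ind S _ _ _ l i])
        show "\<kappa> (p' a) < M \<and> col W (p' a) \<in> S (\<kappa> (p' a))" for a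
          using \<kappa>[OF p'] by (simp add: T_def)
        show "(\<Sum>a\<in>{..k}. c a * col W (p' a) $ i) = 0" if i: "i < m" for i
        proof -
          have "(\<Sum>a\<in>{..k}. c a * col W (p' a) $ i) = (\<Sum>a<k. c a * col W (p' a) $ i) + c k * col W (p' k) $ i"
            by (simp add: lessThan_Suc_atMost[symmetric])
          also have "(\<Sum>a<k. c a * col W (p' a) $ i) = (\<Sum>a<k. Y $$ (a, j) * W $$ (i, p a))"
            using p i by (intro sum.cong) (auto simp: c_def p'_def)
          also have "\<dots> = W $$ (i, j)" using Y_eq[OF _ _ i j] by simp
          finally show ?thesis using i j by (simp add: c_def p'_def)
        qed
      qed simp
      then show ?thesis using i p' by simp
    qed
    have "(\<Sum>a<k. z a * W $$ (i, p a)) = 0" if i: "i < m" for i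
    proof -
      \<comment> \<open>Removing the block of \<open>j\<close> from \<open>c\<close> also removes
        the index \<open>k\<close>, because \<open>p' k = j\<close>; only \<open>z\<close>
        remains.\<close>
      define z' where "z' a = (if \<kappa> (p' a) = \<kappa> j then 0 else c a)" for a
      have "(\<Sum>a<k. z a * W $$ (i, p a)) = (\<Sum>a\<in>{..k}. z' a * W $$ (i, p' a))"
      proof -
        have "(\<Sum>a\<in>{..k}. z' a * W $$ (i, p' a)) = (\<Sum>a<k. z' a * W $$ (i, p' a))"
          by (simp add: lessThan_Suc_atMost[symmetric] z'_def p'_def)
        also have "\<dots> = (\<Sum>a<k. z a * W $$ (i, p a))"
          by (rule sum.cong) (simp_all add: z_def z'_def p'_def c_def)
        finally show ?thesis by (rule sym)
      qed
      also have "\<dots> = (\<Sum>l<M. \<Sum>a\<in>{a\<in>{..k}. \<kappa> (p' a) = l}. z' a * W $$ (i, p' a))"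
        using \<kappa>[OF p'] by (intro sum.group[symmetric]) auto
      also have "\<dots> = (\<Sum>l<M. if l = \<kappa> j then 0
          else \<Sum>a\<in>{a\<in>{..k}. \<kappa> (p' a) = l}. c a * W $$ (i, p' a))"
        by (intro sum.cong) (auto simp: z'_def intro!: sum.cong)
      also have "\<dots> = 0" using rel[OF _ i] by (intro sum.neutral) auto
      finally show ?thesis .
    qed
    then have "(\<Sum>a<k. conjugate (z a) * Y $$ (a, j)) = 0" using Y_orth j by blast
    \<comment> \<open>Where \<open>z\<close> is nonzero it agrees with column \<open>j\<close> of
      \<open>Y\<close>, so its product with that column is its own squared norm.\<close>
    moreover have "conjugate (z a) * Y $$ (a, j) = conjugate (z a) * z a" for a by (simp add: z_def)
    ultimately have "(\<Sum>a<k. conjugate (z a) * z a) = 0" by simp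
    then have "z a = 0" using a by (subst (asm) sum_conjugate_mult_self_eq_0_iff) auto
    then show ?thesis using ne by (simp add: z_def)
  qed

  \<comment> \<open>The graph of nonzero Gram entries\<close>
  define E where "E = {(i, j). i < n \<and> j < n \<and> G $$ (i, j) \<noteq> 0}"
  have Gc: "G \<in> carrier_mat n n" using Yc by (auto simp: G_def)
  have G: "G $$ (i, j) = (\<Sum>a<k. conjugate (Y $$ (a, i)) * Y $$ (a, j))" if "i < n" "j < n" for i j
    unfolding G_def using mat_adjoint_mult_self_index[of i Y j] that Yc by simp
  have G_sym: "G $$ (j, i) = conjugate (G $$ (i, j))" if "i < n" "j < n" for i j
    using that by (simp add: G sum_conjugate conjugate_dist_mul mult.commute)
  have E_\<kappa>: "\<kappa> i = \<kappa> j" if "(i, j) \<in> E" for i j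
  proof (rule ccontr)
    assume ne: "\<kappa> i \<noteq> \<kappa> j"
    have ij: "i < n" "j < n" using that by (auto simp: E_def)
    have "conjugate (Y $$ (a, i)) * Y $$ (a, j) = 0" if "a < k" for a
      using block[OF that ij(1)] block[OF that ij(2)] ne by (cases "\<kappa> (p a) = \<kappa> i") auto
    then have "G $$ (i, j) = 0" unfolding G[OF ij] by (intro sum.neutral) simp
    then show False using that by (simp add: E_def)
  qed
  have walk: "(i, j) \<in> E ^^ d l" if l: "l < M" and ij: "i \<in> T l" "j \<in> T l" for i j l
  proof -
    let ?y = "\<lambda>i a. Y $$ (a, i)"
    \<comment> \<open>Relations pass from \<open>Y\<close> back to \<open>W\<close> through W = C Y;
      together with \<open>Y_rel\<close>, the columns of \<open>Y\<close> inherit independence and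
      spanning within the block.\<close>
    have Y_W: "\<forall>i<m. (\<Sum>a\<in>A. c a * W $$ (i, a)) = 0"
      if A: "A \<subseteq> T l" and c: "\<forall>a<k. (\<Sum>b\<in>A. c b * Y $$ (a, b)) = 0" for A c
    proof (intro allI impI)
      fix i assume i: "i < m"
      have "(\<Sum>b\<in>A. c b * W $$ (i, b)) = (\<Sum>b\<in>A. \<Sum>a<k. W $$ (i, p a) * (c b * Y $$ (a, b)))"
        using A T(2)[of l] Y_eq[OF _ _ i] by (intro sum.cong) (auto simp: sum_distrib_left mult_ac)
      also have "\<dots> = (\<Sum>a<k. W $$ (i, p a) * (\<Sum>b\<in>A. c b * Y $$ (a, b)))"
        unfolding sum_distrib_left by (rule sum.swap)
      also have "\<dots> = 0" using c by simp
      finally show "(\<Sum>b\<in>A. c b * W $$ (i, b)) = 0" .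
    qed
    have "(i, j) \<in> {(a, b). a \<in> T l \<and> b \<in> T l \<and> (\<Sum>p<k. conjugate (?y a p) * ?y b p) \<noteq> 0} ^^ d l"
    proof (rule generic_gram_connected[OF T(1) d[OF l] _ _ ij])
      fix A c assume A: "A \<subseteq> T l" "card A = d l" and c: "\<forall>a<k. (\<Sum>b\<in>A. c b * Y $$ (a, b)) = 0"
      show "\<forall>a\<in>A. c a = 0" by (rule W_indep[OF l l A Y_W[OF A(1) c]])
    next
      fix A b assume A: "A \<subseteq> T l" "card A = d l" and b: "b \<in> T l"
      have bn: "b < n" "col W b \<in> S l" using b by (auto simp: T_def)
      obtain c where c: "\<forall>i<m. col W b $ i = (\<Sum>a\<in>A. c a * W $$ (i, a))"
        using W_span[OF l l A bn(2)] by blast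
      have finA: "finite A" using A T(1) finite_subset by blast
      \<comment> \<open>Coefficients of the relation expressing column \<open>b\<close> by the
        columns in \<open>A\<close>, written so that \<open>b \<in> A\<close> is covered as
        well.\<close>
      define c' where "c' a = (if a \<in> A then c a else 0) - (if a = b then 1 else 0)" for a
      have ins: "(\<Sum>a\<in>insert b A. c' a * f a) = (\<Sum>a\<in>A. c a * f a) - f b" for f :: "nat \<Rightarrow> 'a"
      proof -
        have "(\<Sum>a\<in>insert b A. c' a * f a)
            = (\<Sum>a\<in>insert b A. (if a \<in> A then c a else 0) * f a) - (\<Sum>a\<in>insert b A. (if a = b then 1 else 0) * f a)"
          by (simp only: c'_def left_diff_distrib sum_subtractf)
        also have "(\<Sum>a\<in>insert b A. (if a \<in> A then c a else 0) * f a) = (\<Sum>a\<in>A. c a * f a)"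
          by (rule sum.mono_neutral_cong_right) (use finA in auto)
        also have "(\<Sum>a\<in>insert b A. (if a = b then 1 else 0) * f a) = (\<Sum>a\<in>{b}. f a)"
          by (rule sum.mono_neutral_cong_right) (use finA in auto)
        finally show ?thesis by simp
      qed
      have "(\<Sum>x\<in>insert b A. c' x * Y $$ (a, x)) = 0" if "a < k" for a
      proof (rule Y_rel[OF _ _ _ _ that])
        show "insert b A \<subseteq> {..<n}" using A(1) T(2)[of l] bn by auto
        show "\<forall>i<m. (\<Sum>x\<in>insert b A. c' x * W $$ (i, x)) = 0"
          unfolding ins using c bn by simp
      qed
      then show "\<exists>c. \<forall>a<k. Y $$ (a, b) = (\<Sum>x\<in>A. c x * Y $$ (a, x))"
        unfolding ins by (intro exI[of _ c]) simp
    qed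
    moreover have "{(a, b). a \<in> T l \<and> b \<in> T l \<and> (\<Sum>p<k. conjugate (?y a p) * ?y b p) \<noteq> 0} \<subseteq> E"
    proof clarify
      fix a b assume ab: "a \<in> T l" "b \<in> T l" and ne: "(\<Sum>p<k. conjugate (?y a p) * ?y b p) \<noteq> 0"
      have "a < n" "b < n" using T(2)[of l] ab by auto
      then show "(a, b) \<in> E" using ne by (simp add: E_def G)
    qed
    ultimately show ?thesis using relpow_mono by blast
  qed
  \<comment> \<open>A zero column of \<open>Y\<close> would give a zero column of
    \<open>W\<close>.\<close>
  have E_refl: "(i, i) \<in> E" if i: "i < n" for i
  proof -
    have "\<exists>a<k. Y $$ (a, i) \<noteq> 0"
    proof (rule ccontr)
      assume not: "\<not> (\<exists>a<k. Y $$ (a, i) \<noteq> 0)"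
      have "W $$ (b, i) = 0" if "b < m" for b using Y_eq[OF _ _ that i] not by simp
      then show False using nonzero[of "\<kappa> i" i] \<kappa>[OF i] by blast
    qed
    then have "G $$ (i, i) \<noteq> 0"
      unfolding G[OF i i] by (subst sum_conjugate_mult_self_eq_0_iff) auto
    then show ?thesis using i by (simp add: E_def)
  qed
  have connected: "(i, j) \<in> E ^^ dmax \<longleftrightarrow> (\<exists>l<M. col W i \<in> S l \<and> col W j \<in> S l)"
    if ij: "i < n" "j < n" for i j
  proof
    assume "(i, j) \<in> E ^^ dmax"
    then have "\<kappa> i = \<kappa> j" using E_\<kappa> by (rule relpow_invariant)
    then show "\<exists>l<M. col W i \<in> S l \<and> col W j \<in> S l"
      using \<kappa>[OF ij(1)] \<kappa>[OF ij(2)] by (auto simp: T_def)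
  next
    assume "\<exists>l<M. col W i \<in> S l \<and> col W j \<in> S l"
    then obtain l where l: "l < M" "i \<in> T l" "j \<in> T l" using ij by (auto simp: T_def)
    have "d l \<le> dmax" unfolding dmax_def using l(1) by (intro Max_ge) auto
    then show "(i, j) \<in> E ^^ dmax" using relpow_mono_refl[OF E_refl[OF ij(1)] walk[OF l]] by blast
  qed

  \<comment> \<open>Both choices of Q\<close>
  \<comment> \<open>Each Q applies to \<open>G\<close> entrywise a nonnegative function that
    vanishes only at zero and is invariant under conjugation; Hermitian symmetry of \<open>G\<close>
    then makes Q symmetric.\<close>
  have sim: "similarity_matrix W M S (mat n n (\<lambda>(i, j). of_real (f (G $$ (i, j)))) ^\<^sub>m dmax)"
    if f: "\<And>x. 0 \<le> f x" "\<And>x. f x = 0 \<longleftrightarrow> x = 0" "\<And>x. f (conjugate x) = f x" for f :: "'a \<Rightarrow> real"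
  proof (rule pow_mat_of_real_similarity[OF dimW(2) _ _ refl])
    show "f (G $$ (i, j)) = f (G $$ (j, i))" if "i < n" "j < n" for i j
      using G_sym[OF that] f(3) by simp
    show "(i, j) \<in> {(i, j). i < n \<and> j < n \<and> f (G $$ (i, j)) \<noteq> 0} ^^ dmax \<longleftrightarrow>
        (\<exists>l<M. col W i \<in> S l \<and> col W j \<in> S l)" if "i < n" "j < n" for i j
      using connected[OF that] by (simp add: E_def f(2))
  qed (rule f(1))
  have "bin_mat G = mat n n (\<lambda>(i, j). of_real (if G $$ (i, j) \<noteq> 0 then 1 else 0))"
    using Gc by (intro eq_matI) (auto simp: bin_mat_def)
  moreover have "abs_mat G = mat n n (\<lambda>(i, j). of_real (norm (G $$ (i, j))))"
    using Gc by (intro eq_matI) (auto simp: abs_mat_def)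
  ultimately have "similarity_matrix W M S (bin_mat G ^\<^sub>m dmax) \<and> similarity_matrix W M S (abs_mat G ^\<^sub>m dmax)"
    using sim[of "\<lambda>x. if x \<noteq> 0 then 1 else 0"] sim[of norm] by simp
  then show ?thesis
    by (simp only: Let_def dmax_def d_def[abs_def] G_def Y_def R_def U_def)
qed

end
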